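(* Let $(M,\lambda_{(i)}(x,y))$ be a GAP-space equipped with a non-linear connection $N^\alpha_\mu$. There exists a unique $d$-connection $D=(N^\alpha_\mu,\Gamma^\alpha_{\mu\nu},C^\alpha_{\mu\nu})$ (with the given $N^\alpha_\mu$) such that, for every $i=1,\dots,n$, $$\lambda_{(i)}{}^{\alpha}{}_{|\mu}=0,\qquad \lambda_{(i)}{}^{\alpha}{}_{||\mu}=0 .$$ This $d$-connection is given by $N^\alpha_\mu$ together with $$\Gamma^\alpha_{\mu\nu}=\mathring\Gamma^\alpha_{\mu\nu}+\lambda_{(i)}^{\alpha}\,\lambda_{(i)\mu\mathring{|}\nu},\qquad C^\alpha_{\mu\nu}=\mathring C^\alpha_{\mu\nu}+\lambda_{(i)}^{\alpha}\,\lambda_{(i)\mu\mathring{||}\nu}.$$ Consequently $D$ is metrical: $g_{\mu\nu|\sigma}=0$ and $g_{\mu\nu||\sigma}=0$.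
   Context: $M$ is a $C^\infty$ manifold of dimension $n$, $\pi:TM\to M$ its tangent bundle with induced local coordinates $(x^\mu,y^\mu)$; $\partial_\mu=\partial/\partial x^\mu$, $\dot\partial_\mu=\partial/\partial y^\mu$. All objects are smooth in $(x,y)$; tensor fields are sections of tensor bundles of the pullback bundle $\pi^{-1}(TM)$. Summation convention on repeated Greek and repeated Latin indices. For a change of chart put $p^{\alpha'}_{\alpha}=\partial x^{\alpha'}/\partial x^{\alpha}$, $p^{\epsilon}_{\mu'\nu'}=\partial^2x^\epsilon/\partial x^{\mu'}\partial x^{\nu'}$. A non-linear connection is a system of functions $N^\alpha_\beta(x,y)$ with $N^{\alpha'}_{\beta'}=p^{\alpha'}_{\alpha}p^{\beta}_{\beta'}N^\alpha_\beta+p^{\alpha'}_{\epsilon}p^{\epsilon}_{\beta'\sigma'}y^{\sigma'}$; set $\delta_\mu=\partial_\mu-N^\alpha_\mu\dot\partial_\alpha$. A $d$-connection is a triple $D=(N^\alpha_\mu,\Gamma^\alpha_{\mu\nu},C^\alpha_{\mu\nu})$ where $\Gamma^\alpha_{\mu\nu}(x,y)$ transforms as $\Gamma^{\alpha'}_{\mu'\nu'}=p^{\alpha'}_\alpha p^\mu_{\mu'}p^\nu_{\nu'}\Gamma^\alpha_{\mu\nu}+p^{\alpha'}_\epsilon p^\epsilon_{\mu'\nu'}$ and $C^\alpha_{\mu\nu}(x,y)$ is a tensor. Its $h$- and $v$-covariant derivatives are $A^\alpha_{\mu|\nu}=\delta_\nu A^\alpha_\mu+A^\epsilon_\mu\Gamma^\alpha_{\epsilon\nu}-A^\alpha_\epsilon\Gamma^\epsilon_{\mu\nu}$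 and $A^\alpha_{\mu||\nu}=\dot\partial_\nu A^\alpha_\mu+A^\epsilon_\mu C^\alpha_{\epsilon\nu}-A^\alpha_\epsilon C^\epsilon_{\mu\nu}$, and similarly for other tensor types. A GAP-space is a manifold $M$ together with $n$ global linearly independent sections $\lambda_{(i)}=(\lambda_{(i)}^\alpha(x,y))$ of $\pi^{-1}(TM)$; $(\lambda_{(i)\alpha})$ is the inverse matrix ($\lambda_{(i)}^\alpha\lambda_{(i)\beta}=\delta^\alpha_\beta$, $\lambda_{(i)}^\alpha\lambda_{(j)\alpha}=\delta_{ij}$). Its metric is $g_{\mu\nu}=\lambda_{(i)\mu}\lambda_{(i)\nu}$, with inverse $g^{\mu\nu}$. The Riemannian $d$-connection is $\mathring D=(N^\alpha_\mu,\mathring\Gamma^\alpha_{\mu\nu},\mathring C^\alpha_{\mu\nu})$ with $\mathring\Gamma^\alpha_{\mu\nu}=\tfrac12g^{\alpha\epsilon}(\delta_\mu g_{\nu\epsilon}+\delta_\nu g_{\mu\epsilon}-\delta_\epsilon g_{\mu\nu})$ and $\mathring C^\alpha_{\mu\nu}=\tfrac12g^{\alpha\epsilon}(\dot\partial_\mu g_{\nu\epsilon}+\dot\partial_\nu g_{\mu\epsilon}-\dot\partial_\epsilon g_{\mu\nu})$; $\mathring{|}$ and $\mathring{||}$ denote its $h$- and $v$-covariant derivatives, while $|$ and $||$ denote those of $D$. *)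

theory Defs
  imports "HOL-Analysis.Analysis"
begin

section \<open>Smooth maps between normed spaces\<close>

text \<open>Intended for open \<open>S\<close> and finite-dimensional domains, where continuity of all iterated
  directional derivatives up to order \<open>k\<close> is the usual notion of class \<open>C\<^sup>k\<close>.\<close>

primrec Ck_on :: "nat \<Rightarrow> ('a::real_normed_vector \<Rightarrow> 'b::real_normed_vector) \<Rightarrow> 'a set \<Rightarrow> bool" where
  "Ck_on 0 f S \<longleftrightarrow> continuous_on S f"
| "Ck_on (Suc k) f S \<longleftrightarrow> (\<forall>x\<in>S. f differentiable (at x)) \<and>
     (\<forall>v. Ck_on k (\<lambda>x. frechet_derivative f (at x) v) S)"

definition smooth_on :: "('a::real_normed_vector \<Rightarrow> 'b::real_normed_vector) \<Rightarrow> 'a set \<Rightarrow> bool" where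
  "smooth_on f S \<longleftrightarrow> (\<forall>k. Ck_on k f S)"


section \<open>Smooth manifolds\<close>

text \<open>A chart is a pair of its domain and its coordinate map; the dimension is \<open>CARD('n)\<close>.\<close>

type_synonym ('m, 'n) chart = "'m set \<times> ('m \<Rightarrow> real ^ 'n)"

definition transition :: "('m, 'n::finite) chart \<Rightarrow> ('m, 'n) chart \<Rightarrow> real ^ 'n \<Rightarrow> real ^ 'n" where
  "transition c c' = snd c' \<circ> inv_into (fst c) (snd c)"

text \<open>The atlas need not be maximal; a maximal atlas is a special case.\<close>

definition smooth_manifold :: "'m topology \<Rightarrow> ('m, 'n::finite) chart set \<Rightarrow> bool" where
  "smooth_manifold X A \<longleftrightarrow>
     Hausdorff_space X \<and> second_countable X \<and> topspace X = \<Union> (fst ` A) \<and>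
     (\<forall>(U, \<phi>)\<in>A. openin X U \<and> open (\<phi> ` U) \<and>
        homeomorphic_map (subtopology X U) (top_of_set (\<phi> ` U)) \<phi>) \<and>
     (\<forall>c\<in>A. \<forall>c'\<in>A. smooth_on (transition c c') (snd c ` (fst c \<inter> fst c')))"

text \<open>\<open>jac c c' x a' a\<close> is \<open>\<partial>x\<^sup>a\<^sup>'/\<partial>x\<^sup>a\<close> and \<open>hess c c' x a' m n\<close> is
  \<open>\<partial>\<^sup>2x\<^sup>a\<^sup>'/\<partial>x\<^sup>m\<partial>x\<^sup>n\<close>, where \<open>c\<close> carries the coordinates \<open>x\<^sup>a\<close> and \<open>c'\<close> the
  coordinates \<open>x\<^sup>a\<^sup>'\<close>. For the functions with the roles of \<open>c\<close> and \<open>c'\<close> exchanged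
  the point is to be given in the coordinates of \<open>c'\<close>.\<close>

definition jac :: "('m, 'n::finite) chart \<Rightarrow> ('m, 'n) chart \<Rightarrow> real ^ 'n \<Rightarrow> 'n \<Rightarrow> 'n \<Rightarrow> real" where
  "jac c c' x a' a = frechet_derivative (\<lambda>x. transition c c' x $ a') (at x) (axis a 1)"

definition hess ::
  "('m, 'n::finite) chart \<Rightarrow> ('m, 'n) chart \<Rightarrow> real ^ 'n \<Rightarrow> 'n \<Rightarrow> 'n \<Rightarrow> 'n \<Rightarrow> real" where
  "hess c c' x a' m n = frechet_derivative (\<lambda>x. jac c c' x a' n) (at x) (axis m 1)"


section \<open>The tangent bundle and its pullback\<close>

text \<open>A tangent vector at \<open>p\<close> is the family of its component vectors in the charts around \<open>p\<close>,
  related by the Jacobians of the transition maps (and set to 0 at all other pairs, so that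
  equality of tangent vectors is equality of families).\<close>

type_synonym ('m, 'n) tangent = "'m \<times> (('m, 'n) chart \<Rightarrow> real ^ 'n)"

definition tangent_bundle :: "('m, 'n::finite) chart set \<Rightarrow> ('m, 'n) tangent set" where
  "tangent_bundle A = {(p, v). p \<in> \<Union> (fst ` A) \<and>
     (\<forall>c\<in>A. \<forall>c'\<in>A. p \<in> fst c \<inter> fst c' \<longrightarrow>
        (\<forall>a'. v c' $ a' = (\<Sum>a\<in>UNIV. jac c c' (snd c p) a' a * v c $ a))) \<and>
     (\<forall>c. \<not> (c \<in> A \<and> p \<in> fst c) \<longrightarrow> v c = 0)}"

text \<open>The induced coordinates \<open>(x, y)\<close> on the tangent bundle and their range.\<close>

type_synonym 'n point = "(real ^ 'n) \<times> (real ^ 'n)"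

definition tcoords :: "('m, 'n::finite) chart \<Rightarrow> ('m, 'n) tangent \<Rightarrow> 'n point" where
  "tcoords c u = (snd c (fst u), snd u c)"

definition tdom :: "('m, 'n::finite) chart \<Rightarrow> 'n point set" where
  "tdom c = (snd c ` fst c) \<times> UNIV"

text \<open>The fibre of the pullback bundle over \<open>u\<close> is the tangent space at the base point of \<open>u\<close>,
  so its sections are the maps of the tangent bundle to itself that preserve base points.\<close>

definition components ::
  "('m, 'n::finite) chart set \<Rightarrow> (('m, 'n) tangent \<Rightarrow> ('m, 'n) tangent) \<Rightarrow>
   ('m, 'n) chart \<Rightarrow> 'n point \<Rightarrow> 'n \<Rightarrow> real" where
  "components A s c z a =
     snd (s (inv_into {u \<in> tangent_bundle A. fst u \<in> fst c} (tcoords c) z)) c $ a"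

definition pullback_section ::
  "('m, 'n::finite) chart set \<Rightarrow> (('m, 'n) tangent \<Rightarrow> ('m, 'n) tangent) \<Rightarrow> bool" where
  "pullback_section A s \<longleftrightarrow>
     (\<forall>u\<in>tangent_bundle A. s u \<in> tangent_bundle A \<and> fst (s u) = fst u) \<and>
     (\<forall>c\<in>A. \<forall>a. smooth_on (\<lambda>z. components A s c z a) (tdom c))"


section \<open>Non-linear connections and d-connections\<close>

text \<open>Geometric objects on the tangent bundle are systems of component functions, one for each
  chart; only their values on \<open>tdom c\<close>, for charts \<open>c\<close> of the atlas, are meaningful.
  Upper indices come before lower ones.\<close>

type_synonym ('m, 'n) system2 = "('m, 'n) chart \<Rightarrow> 'n point \<Rightarrow> 'n \<Rightarrow> 'n \<Rightarrow> real"
type_synonym ('m, 'n) system3 = "('m, 'n) chart \<Rightarrow> 'n point \<Rightarrow> 'n \<Rightarrow> 'n \<Rightarrow> 'n \<Rightarrow> real"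

definition nonlinear_connection ::
  "('m, 'n::finite) chart set \<Rightarrow> ('m, 'n) system2 \<Rightarrow> bool" where
  "nonlinear_connection A N \<longleftrightarrow>
     (\<forall>c\<in>A. \<forall>a b. smooth_on (\<lambda>z. N c z a b) (tdom c)) \<and>
     (\<forall>c\<in>A. \<forall>c'\<in>A. \<forall>u\<in>tangent_bundle A. fst u \<in> fst c \<inter> fst c' \<longrightarrow>
        (let (x, y) = tcoords c u; (x', y') = tcoords c' u in
          \<forall>a' b'. N c' (x', y') a' b' =
            (\<Sum>a\<in>UNIV. \<Sum>b\<in>UNIV. jac c c' x a' a * jac c' c x' b b' * N c (x, y) a b) +
            (\<Sum>e\<in>UNIV. \<Sum>s'\<in>UNIV. jac c c' x a' e * hess c' c x' e b' s' * y' $ s')))"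

definition h_coefficients ::
  "('m, 'n::finite) chart set \<Rightarrow> ('m, 'n) system3 \<Rightarrow> bool" where
  "h_coefficients A \<Gamma> \<longleftrightarrow>
     (\<forall>c\<in>A. \<forall>a m n. smooth_on (\<lambda>z. \<Gamma> c z a m n) (tdom c)) \<and>
     (\<forall>c\<in>A. \<forall>c'\<in>A. \<forall>u\<in>tangent_bundle A. fst u \<in> fst c \<inter> fst c' \<longrightarrow>
        (let (x, y) = tcoords c u; (x', y') = tcoords c' u in
          \<forall>a' m' n'. \<Gamma> c' (x', y') a' m' n' =
            (\<Sum>a\<in>UNIV. \<Sum>m\<in>UNIV. \<Sum>n\<in>UNIV.
               jac c c' x a' a * jac c' c x' m m' * jac c' c x' n n' * \<Gamma> c (x, y) a m n) +
            (\<Sum>e\<in>UNIV. jac c c' x a' e * hess c' c x' e m' n')))"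

definition tensor_1_2 ::
  "('m, 'n::finite) chart set \<Rightarrow> ('m, 'n) system3 \<Rightarrow> bool" where
  "tensor_1_2 A C \<longleftrightarrow>
     (\<forall>c\<in>A. \<forall>a m n. smooth_on (\<lambda>z. C c z a m n) (tdom c)) \<and>
     (\<forall>c\<in>A. \<forall>c'\<in>A. \<forall>u\<in>tangent_bundle A. fst u \<in> fst c \<inter> fst c' \<longrightarrow>
        (let (x, y) = tcoords c u; (x', y') = tcoords c' u in
          \<forall>a' m' n'. C c' (x', y') a' m' n' =
            (\<Sum>a\<in>UNIV. \<Sum>m\<in>UNIV. \<Sum>n\<in>UNIV.
               jac c c' x a' a * jac c' c x' m m' * jac c' c x' n n' * C c (x, y) a m n)))"

definition d_connection ::
  "('m, 'n::finite) chart set \<Rightarrow> ('m, 'n) system2 \<Rightarrow> ('m, 'n) system3 \<Rightarrow> ('m, 'n) system3 \<Rightarrow> bool"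
  where
  "d_connection A N \<Gamma> C \<longleftrightarrow>
     nonlinear_connection A N \<and> h_coefficients A \<Gamma> \<and> tensor_1_2 A C"

definition same_system ::
  "('m, 'n::finite) chart set \<Rightarrow> ('m, 'n) system3 \<Rightarrow> ('m, 'n) system3 \<Rightarrow> bool" where
  "same_system A S T \<longleftrightarrow> (\<forall>c\<in>A. \<forall>z\<in>tdom c. S c z = T c z)"


section \<open>Covariant derivatives\<close>

definition dx :: "'n::finite \<Rightarrow> ('n point \<Rightarrow> real) \<Rightarrow> 'n point \<Rightarrow> real" where
  "dx m f z = frechet_derivative f (at z) (axis m 1, 0)"

definition dy :: "'n::finite \<Rightarrow> ('n point \<Rightarrow> real) \<Rightarrow> 'n point \<Rightarrow> real" where
  "dy m f z = frechet_derivative f (at z) (0, axis m 1)"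

definition delta ::
  "('n::finite point \<Rightarrow> 'n \<Rightarrow> 'n \<Rightarrow> real) \<Rightarrow> 'n \<Rightarrow> ('n point \<Rightarrow> real) \<Rightarrow> 'n point \<Rightarrow> real" where
  "delta N m f z = dx m f z - (\<Sum>a\<in>UNIV. N z a m * dy a f z)"

text \<open>Covariant derivatives, in one chart, of objects of type (1,0), (0,1) and (0,2). The
  \<open>h\<close>-derivatives are obtained for \<open>d = delta N\<close> and \<open>G = \<Gamma>\<close>, the \<open>v\<close>-derivatives for
  \<open>d = dy\<close> and \<open>G = C\<close>. The last index is the index of differentiation.\<close>

definition cov_vector ::
  "('n::finite \<Rightarrow> ('n point \<Rightarrow> real) \<Rightarrow> 'n point \<Rightarrow> real) \<Rightarrow> ('n point \<Rightarrow> 'n \<Rightarrow> 'n \<Rightarrow> 'n \<Rightarrow> real) \<Rightarrow>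
   ('n point \<Rightarrow> 'n \<Rightarrow> real) \<Rightarrow> 'n point \<Rightarrow> 'n \<Rightarrow> 'n \<Rightarrow> real" where
  "cov_vector d G V z a n = d n (\<lambda>w. V w a) z + (\<Sum>e\<in>UNIV. V z e * G z a e n)"

definition cov_covector ::
  "('n::finite \<Rightarrow> ('n point \<Rightarrow> real) \<Rightarrow> 'n point \<Rightarrow> real) \<Rightarrow> ('n point \<Rightarrow> 'n \<Rightarrow> 'n \<Rightarrow> 'n \<Rightarrow> real) \<Rightarrow>
   ('n point \<Rightarrow> 'n \<Rightarrow> real) \<Rightarrow> 'n point \<Rightarrow> 'n \<Rightarrow> 'n \<Rightarrow> real" where
  "cov_covector d G W z m n = d n (\<lambda>w. W w m) z - (\<Sum>e\<in>UNIV. W z e * G z e m n)"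

definition cov_tensor_0_2 ::
  "('n::finite \<Rightarrow> ('n point \<Rightarrow> real) \<Rightarrow> 'n point \<Rightarrow> real) \<Rightarrow> ('n point \<Rightarrow> 'n \<Rightarrow> 'n \<Rightarrow> 'n \<Rightarrow> real) \<Rightarrow>
   ('n point \<Rightarrow> 'n \<Rightarrow> 'n \<Rightarrow> real) \<Rightarrow> 'n point \<Rightarrow> 'n \<Rightarrow> 'n \<Rightarrow> 'n \<Rightarrow> real" where
  "cov_tensor_0_2 d G B z m n s = d s (\<lambda>w. B w m n) z
     - (\<Sum>e\<in>UNIV. B z e n * G z e m s) - (\<Sum>e\<in>UNIV. B z m e * G z e n s)"


section \<open>GAP-spaces\<close>

text \<open>Linear independence at \<open>u\<close> is read off in a chart around the base point of \<open>u\<close>, where the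
  vector space structure of the tangent space is that of the component vectors.\<close>

definition GAP_space ::
  "'m topology \<Rightarrow> ('m, 'n::finite) chart set \<Rightarrow>
   ('n \<Rightarrow> ('m, 'n) tangent \<Rightarrow> ('m, 'n) tangent) \<Rightarrow> bool" where
  "GAP_space X A lam \<longleftrightarrow> smooth_manifold X A \<and>
     (\<forall>i. pullback_section A (lam i)) \<and>
     (\<forall>u\<in>tangent_bundle A. \<forall>c\<in>A. fst u \<in> fst c \<longrightarrow>
        (\<forall>k :: 'n \<Rightarrow> real. (\<Sum>i\<in>UNIV. k i *\<^sub>R snd (lam i u) c) = 0 \<longrightarrow> (\<forall>i. k i = 0)))"

text \<open>\<open>frame A lam c z i a\<close> is \<open>\<lambda>\<^sub>(\<^sub>i\<^sub>)\<^sup>a\<close> and \<open>coframe A lam c z i a\<close> is \<open>\<lambda>\<^sub>(\<^sub>i\<^sub>)\<^sub>a\<close>.\<close>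

definition frame ::
  "('m, 'n::finite) chart set \<Rightarrow> ('n \<Rightarrow> ('m, 'n) tangent \<Rightarrow> ('m, 'n) tangent) \<Rightarrow>
   ('m, 'n) chart \<Rightarrow> 'n point \<Rightarrow> 'n \<Rightarrow> 'n \<Rightarrow> real" where
  "frame A lam c z i a = components A (lam i) c z a"

definition coframe ::
  "('m, 'n::finite) chart set \<Rightarrow> ('n \<Rightarrow> ('m, 'n) tangent \<Rightarrow> ('m, 'n) tangent) \<Rightarrow>
   ('m, 'n) chart \<Rightarrow> 'n point \<Rightarrow> 'n \<Rightarrow> 'n \<Rightarrow> real" where
  "coframe A lam c z i a = matrix_inv (\<chi> i a. frame A lam c z i a) $ a $ i"

definition metric ::
  "('m, 'n::finite) chart set \<Rightarrow> ('n \<Rightarrow> ('m, 'n) tangent \<Rightarrow> ('m, 'n) tangent) \<Rightarrow>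
   ('m, 'n) system2" where
  "metric A lam c z m n = (\<Sum>i\<in>UNIV. coframe A lam c z i m * coframe A lam c z i n)"

definition inverse_metric ::
  "('m, 'n::finite) chart set \<Rightarrow> ('n \<Rightarrow> ('m, 'n) tangent \<Rightarrow> ('m, 'n) tangent) \<Rightarrow>
   ('m, 'n) system2" where
  "inverse_metric A lam c z m n = matrix_inv (\<chi> m n. metric A lam c z m n) $ m $ n"

text \<open>The Christoffel-type expression formed with a system of derivations \<open>d\<close>.\<close>

definition christoffel ::
  "('n::finite \<Rightarrow> ('n point \<Rightarrow> real) \<Rightarrow> 'n point \<Rightarrow> real) \<Rightarrow> ('n point \<Rightarrow> 'n \<Rightarrow> 'n \<Rightarrow> real) \<Rightarrow>
   ('n point \<Rightarrow> 'n \<Rightarrow> 'n \<Rightarrow> real) \<Rightarrow> 'n point \<Rightarrow> 'n \<Rightarrow> 'n \<Rightarrow> 'n \<Rightarrow> real" where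
  "christoffel d g ginv z a m n = 1 / 2 * (\<Sum>e\<in>UNIV. ginv z a e *
     (d m (\<lambda>w. g w n e) z + d n (\<lambda>w. g w m e) z - d e (\<lambda>w. g w m n) z))"

definition riemann_\<Gamma> ::
  "('m, 'n::finite) chart set \<Rightarrow> ('n \<Rightarrow> ('m, 'n) tangent \<Rightarrow> ('m, 'n) tangent) \<Rightarrow>
   ('m, 'n) system2 \<Rightarrow> ('m, 'n) system3" where
  "riemann_\<Gamma> A lam N c = christoffel (delta (N c)) (metric A lam c) (inverse_metric A lam c)"

definition riemann_C ::
  "('m, 'n::finite) chart set \<Rightarrow> ('n \<Rightarrow> ('m, 'n) tangent \<Rightarrow> ('m, 'n) tangent) \<Rightarrow>
   ('m, 'n) system3" where
  "riemann_C A lam c = christoffel dy (metric A lam c) (inverse_metric A lam c)"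

definition frame_parallel ::
  "('m, 'n::finite) chart set \<Rightarrow> ('n \<Rightarrow> ('m, 'n) tangent \<Rightarrow> ('m, 'n) tangent) \<Rightarrow>
   ('m, 'n) system2 \<Rightarrow> ('m, 'n) system3 \<Rightarrow> ('m, 'n) system3 \<Rightarrow> bool" where
  "frame_parallel A lam N \<Gamma> C \<longleftrightarrow> (\<forall>i. \<forall>c\<in>A. \<forall>z\<in>tdom c. \<forall>a m.
     cov_vector (delta (N c)) (\<Gamma> c) (\<lambda>w. frame A lam c w i) z a m = 0 \<and>
     cov_vector dy (C c) (\<lambda>w. frame A lam c w i) z a m = 0)"

definition metrical ::
  "('m, 'n::finite) chart set \<Rightarrow> ('n \<Rightarrow> ('m, 'n) tangent \<Rightarrow> ('m, 'n) tangent) \<Rightarrow>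
   ('m, 'n) system2 \<Rightarrow> ('m, 'n) system3 \<Rightarrow> ('m, 'n) system3 \<Rightarrow> bool" where
  "metrical A lam N \<Gamma> C \<longleftrightarrow> (\<forall>c\<in>A. \<forall>z\<in>tdom c. \<forall>m n s.
     cov_tensor_0_2 (delta (N c)) (\<Gamma> c) (metric A lam c) z m n s = 0 \<and>
     cov_tensor_0_2 dy (C c) (metric A lam c) z m n s = 0)"

end

theory Submission
  imports Defs
begin

text \<open>
  The condition that the frame be parallel is linear in the connection coefficients, and the
  frame matrix is invertible, so it can be solved: it holds exactly for the Weitzenboeck coefficients
  \<open>\<lambda>\<^sub>(\<^sub>i\<^sub>)\<^sup>a d\<^sub>n \<lambda>\<^sub>(\<^sub>i\<^sub>)\<^sub>m\<close>, where \<open>d\<^sub>n\<close> is \<open>\<delta>\<^sub>n\<close> for the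
  h-part and the vertical derivative for the v-part. Expanding the covariant derivative of the coframe in the
  formula with the Riemannian connection, the Riemannian coefficients cancel by duality, whatever they
  are. Metricity is the product rule for \<open>g\<^sub>m\<^sub>n = \<lambda>\<^sub>(\<^sub>i\<^sub>)\<^sub>m \<lambda>\<^sub>(\<^sub>i\<^sub>)\<^sub>n\<close>.
  In the change of chart, the law of \<open>N\<close> makes \<open>\<delta>\<^sub>n\<close> transform as a covector, and the
  inhomogeneous term arises from differentiating the Jacobian in the law of the coframe; its two lower
  indices come out in the opposite order, which is where the symmetry of second derivatives enters.
\<close>

section \<open>Smooth functions\<close>

lemma frechet_derivative_eqI: "(f has_derivative f') (at x) \<Longrightarrow> frechet_derivative f (at x) = f'"
  by (simp add: frechet_derivative_at[symmetric])

text \<open>On an open set, differentiability and the derivative at a point depend only on the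
  values in the set, and this passes to the iterated derivatives. In the closure lemmas it allows a
  derivative to be replaced by the formula that a differentiation rule gives for it.\<close>

lemma Ck_on_cong:
  assumes "open S" "\<And>x. x \<in> S \<Longrightarrow> f x = g x" "Ck_on k f S"
  shows "Ck_on k g S"
  using assms(2,3)
proof (induction k arbitrary: f g)
  case 0
  then show ?case by (simp cong: continuous_on_cong)
next
  case (Suc k)
  have d: "f differentiable (at x)" if "x \<in> S" for x
    using Suc.prems that by simp
  have "g differentiable (at x)" if "x \<in> S" for x
    using d[OF that] Suc.prems(1) assms(1) that
    by (meson differentiable_def has_derivative_transform_within_open)
  moreover have "frechet_derivative f (at x) v = frechet_derivative g (at x) v" if "x \<in> S" for x v
    using frechet_derivative_transform_within_open[OF d[OF that] assms(1) that] Suc.prems(1) by auto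
  then have "Ck_on k (\<lambda>x. frechet_derivative g (at x) v) S" for v
    using Suc.IH Suc.prems(2) by (metis (no_types, lifting) Ck_on.simps(2))
  ultimately show ?case by simp
qed

text \<open>The product rule contains the functions themselves next to their derivatives; this
  brings both down to the class of the induction hypothesis.\<close>

lemma Ck_on_SucD: "Ck_on (Suc k) f S \<Longrightarrow> Ck_on k f S"
proof (induction k arbitrary: f)
  case 0
  then show ?case
    by (simp add: differentiable_at_imp_differentiable_on differentiable_imp_continuous_on)
next
  case (Suc k)
  then show ?case by (metis Ck_on.simps(2))
qed

lemma Ck_on_const: "Ck_on k (\<lambda>x. b) S"
  by (induction k arbitrary: b) auto

lemma Ck_on_bounded_linear:
  assumes "bounded_linear h" "open S"
  shows "Ck_on k f S \<Longrightarrow> Ck_on k (\<lambda>x. h (f x)) S"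
proof (induction k arbitrary: f)
  case 0
  then show ?case using assms by (simp add: bounded_linear.continuous_on)
next
  case (Suc k)
  have hd: "((\<lambda>x. h (f x)) has_derivative (\<lambda>v. h (frechet_derivative f (at x) v))) (at x)"
    if "x \<in> S" for x
    using Suc.prems that
    by (intro bounded_linear.has_derivative[OF assms(1)]) (auto simp: frechet_derivative_works[symmetric])
  have "Ck_on k (\<lambda>x. h (frechet_derivative f (at x) v)) S" for v
    using Suc by simp
  then have "Ck_on k (\<lambda>x. frechet_derivative (\<lambda>x. h (f x)) (at x) v) S" for v
    by (rule Ck_on_cong[OF assms(2), rotated]) (simp add: frechet_derivative_eqI[OF hd])
  then show ?case using hd by (auto simp: differentiable_def)
qed

lemma Ck_on_add:
  assumes "open S"
  shows "Ck_on k f S \<Longrightarrow> Ck_on k g S \<Longrightarrow> Ck_on k (\<lambda>x. f x + g x) S"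
proof (induction k arbitrary: f g)
  case 0
  then show ?case by (simp add: continuous_on_add)
next
  case (Suc k)
  have hd: "((\<lambda>x. f x + g x) has_derivative
      (\<lambda>v. frechet_derivative f (at x) v + frechet_derivative g (at x) v)) (at x)"
    if "x \<in> S" for x
    using Suc.prems that by (intro has_derivative_add) (auto simp: frechet_derivative_works[symmetric])
  have "Ck_on k (\<lambda>x. frechet_derivative f (at x) v + frechet_derivative g (at x) v) S" for v
    using Suc by simp
  then have "Ck_on k (\<lambda>x. frechet_derivative (\<lambda>x. f x + g x) (at x) v) S" for v
    by (rule Ck_on_cong[OF assms, rotated]) (simp add: frechet_derivative_eqI[OF hd])
  then show ?case using hd by (auto simp: differentiable_def)
qed

lemma Ck_on_mult:
  fixes f g :: "'a::real_normed_vector \<Rightarrow> real"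
  assumes "open S"
  shows "Ck_on k f S \<Longrightarrow> Ck_on k g S \<Longrightarrow> Ck_on k (\<lambda>x. f x * g x) S"
proof (induction k arbitrary: f g)
  case 0
  then show ?case by (simp add: continuous_on_mult)
next
  case (Suc k)
  have hd: "((\<lambda>x. f x * g x) has_derivative
      (\<lambda>v. f x * frechet_derivative g (at x) v + frechet_derivative f (at x) v * g x)) (at x)"
    if "x \<in> S" for x
    using Suc.prems that by (intro has_derivative_mult) (auto simp: frechet_derivative_works[symmetric])
  have "Ck_on k (\<lambda>x. f x * frechet_derivative g (at x) v + frechet_derivative f (at x) v * g x) S" for v
    using Suc.prems Ck_on_SucD[OF Suc.prems(1)] Ck_on_SucD[OF Suc.prems(2)]
    by (intro Ck_on_add[OF assms] Suc.IH) auto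
  then have "Ck_on k (\<lambda>x. frechet_derivative (\<lambda>x. f x * g x) (at x) v) S" for v
    by (rule Ck_on_cong[OF assms, rotated]) (simp add: frechet_derivative_eqI[OF hd])
  then show ?case using hd by (auto simp: differentiable_def)
qed

lemma Ck_on_inverse:
  fixes f :: "'a::real_normed_vector \<Rightarrow> real"
  assumes "open S" "\<And>x. x \<in> S \<Longrightarrow> f x \<noteq> 0"
  shows "Ck_on k f S \<Longrightarrow> Ck_on k (\<lambda>x. inverse (f x)) S"
proof (induction k)
  case 0
  then show ?case using assms by (simp add: continuous_on_inverse)
next
  case (Suc k)
  have hd: "((\<lambda>x. inverse (f x)) has_derivative
      (\<lambda>v. (-1) * ((inverse (f x) * frechet_derivative f (at x) v) * inverse (f x)))) (at x)"
    if "x \<in> S" for x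
    using Suc.prems assms that
    by (intro has_derivative_eq_rhs[OF Deriv.has_derivative_inverse])
       (auto simp: frechet_derivative_works[symmetric])
  \<comment> \<open>The derivative is a product of the derivative of \<open>f\<close> and two copies
    of \<open>inverse (f x)\<close>, so the induction hypothesis for the same \<open>f\<close>
    covers it.\<close>
  have "Ck_on k (\<lambda>x. (-1) * ((inverse (f x) * frechet_derivative f (at x) v) * inverse (f x))) S" for v
    using Suc.prems Suc.IH[OF Ck_on_SucD[OF Suc.prems]]
    by (intro Ck_on_mult[OF assms(1)] Ck_on_const) auto
  note deriv = this
  have "Ck_on k (\<lambda>x. frechet_derivative (\<lambda>x. inverse (f x)) (at x) v) S" for v
    by (rule Ck_on_cong[OF assms(1) _ deriv[of v]]) (simp add: frechet_derivative_eqI[OF hd])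
  then show ?case using hd by (auto simp: differentiable_def)
qed

section \<open>Rules for the class of smooth maps\<close>

lemma smooth_on_differentiable: "smooth_on f S \<Longrightarrow> x \<in> S \<Longrightarrow> f differentiable (at x)"
  unfolding smooth_on_def by (metis Ck_on.simps(2))

lemma smooth_on_frechet_derivative: "smooth_on f S \<Longrightarrow> smooth_on (\<lambda>x. frechet_derivative f (at x) v) S"
  unfolding smooth_on_def by (metis Ck_on.simps(2))

lemma smooth_on_continuous_on: "smooth_on f S \<Longrightarrow> continuous_on S f"
  unfolding smooth_on_def by (metis Ck_on.simps(1))

lemma smooth_on_const: "smooth_on (\<lambda>x. b) S"
  by (simp add: smooth_on_def Ck_on_const)

lemma smooth_on_if: "smooth_on f S \<Longrightarrow> smooth_on g S \<Longrightarrow> smooth_on (\<lambda>x. if P then f x else g x) S"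
  by (cases P) simp_all

lemma smooth_on_cong:
  "open S \<Longrightarrow> (\<And>x. x \<in> S \<Longrightarrow> f x = g x) \<Longrightarrow> smooth_on f S \<Longrightarrow> smooth_on g S"
  using Ck_on_cong unfolding smooth_on_def by blast

lemma smooth_on_bounded_linear:
  "bounded_linear h \<Longrightarrow> open S \<Longrightarrow> smooth_on f S \<Longrightarrow> smooth_on (\<lambda>x. h (f x)) S"
  by (simp add: smooth_on_def Ck_on_bounded_linear)

lemma smooth_on_add:
  "open S \<Longrightarrow> smooth_on f S \<Longrightarrow> smooth_on g S \<Longrightarrow> smooth_on (\<lambda>x. f x + g x) S"
  by (simp add: smooth_on_def Ck_on_add)

lemma smooth_on_mult:
  fixes f g :: "'a::real_normed_vector \<Rightarrow> real"
  shows "open S \<Longrightarrow> smooth_on f S \<Longrightarrow> smooth_on g S \<Longrightarrow> smooth_on (\<lambda>x. f x * g x) S"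
  by (simp add: smooth_on_def Ck_on_mult)

lemma smooth_on_inverse:
  fixes f :: "'a::real_normed_vector \<Rightarrow> real"
  shows "open S \<Longrightarrow> (\<And>x. x \<in> S \<Longrightarrow> f x \<noteq> 0) \<Longrightarrow> smooth_on f S \<Longrightarrow> smooth_on (\<lambda>x. inverse (f x)) S"
  by (simp add: smooth_on_def Ck_on_inverse)

lemma smooth_on_diff:
  fixes f g :: "'a::real_normed_vector \<Rightarrow> real"
  assumes "open S" "smooth_on f S" "smooth_on g S"
  shows "smooth_on (\<lambda>x. f x - g x) S"
  using smooth_on_add[OF assms(1,2) smooth_on_mult[OF assms(1) smooth_on_const[of "-1"] assms(3)]]
  by simp

lemma smooth_on_sum:
  assumes "open S" "\<And>i. i \<in> I \<Longrightarrow> smooth_on (f i) S"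
  shows "smooth_on (\<lambda>x. \<Sum>i\<in>I. f i x) S"
  using assms(2)
  by (induction I rule: infinite_finite_induct) (auto simp: smooth_on_const intro!: smooth_on_add[OF assms(1)])

lemma smooth_on_prod:
  fixes f :: "'i \<Rightarrow> 'a::real_normed_vector \<Rightarrow> real"
  assumes "open S" "\<And>i. i \<in> I \<Longrightarrow> smooth_on (f i) S"
  shows "smooth_on (\<lambda>x. \<Prod>i\<in>I. f i x) S"
  using assms(2)
  by (induction I rule: infinite_finite_induct) (auto simp: smooth_on_const intro!: smooth_on_mult[OF assms(1)])

section \<open>Determinants and inverses of matrices of smooth functions\<close>

lemma smooth_on_det:
  fixes F :: "'a::real_normed_vector \<Rightarrow> 'n::finite \<Rightarrow> 'n \<Rightarrow> real"
  assumes "open S" "\<And>i j. smooth_on (\<lambda>x. F x i j) S"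
  shows "smooth_on (\<lambda>x. det (\<chi> i j. F x i j)) S"
  unfolding det_def using assms
  by (auto intro!: smooth_on_sum smooth_on_mult smooth_on_prod smooth_on_const)

lemma invertible_matrix_inv:
  fixes M :: "real^'n^'n"
  assumes "invertible M"
  shows "M ** matrix_inv M = mat 1" "matrix_inv M ** M = mat 1"
  using someI_ex[OF assms[unfolded invertible_def]] unfolding matrix_inv_def by auto

text \<open>Column \<open>k\<close> of the inverse solves the linear system with right-hand side
  \<open>axis k 1\<close>, so Cramer's rule applies. The entries of the inverse thus become
  quotients of polynomials in the entries of \<open>M\<close>, from which their smoothness can be
  read off.\<close>

lemma matrix_inv_cramer:
  fixes M :: "real^'n^'n"
  assumes "invertible M"
  shows "matrix_inv M $ a $ k = det (\<chi> i j. if j = a then (if i = k then 1 else 0) else M $ i $ j) * inverse (det M)"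
proof -
  have "M *v (matrix_inv M *v axis k 1) = axis k 1"
    using assms by (simp add: matrix_vector_mul_assoc invertible_matrix_inv(1))
  then have "(matrix_inv M *v axis k 1) $ a = det (\<chi> i j. if j = a then axis k 1 $ i else M $ i $ j) / det M"
    using assms by (subst (asm) cramer) (auto simp: invertible_det_nz)
  moreover have "(matrix_inv M *v axis k 1) $ a = matrix_inv M $ a $ k"
    by (simp add: matrix_vector_mul_component inner_axis)
  ultimately show ?thesis
    by (simp add: axis_def divide_inverse cong: if_cong)
qed

lemma smooth_on_matrix_inv:
  fixes F :: "'a::real_normed_vector \<Rightarrow> 'n::finite \<Rightarrow> 'n \<Rightarrow> real"
  assumes "open S" "\<And>i j. smooth_on (\<lambda>x. F x i j) S" "\<And>x. x \<in> S \<Longrightarrow> invertible (\<chi> i j. F x i j)"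
  shows "smooth_on (\<lambda>x. matrix_inv (\<chi> i j. F x i j) $ a $ k) S"
proof (rule smooth_on_cong[OF assms(1)])
  show "smooth_on (\<lambda>x. det (\<chi> i j. if j = a then (if i = k then 1 else 0) else F x i j) *
      inverse (det (\<chi> i j. F x i j))) S"
    using assms
    by (intro smooth_on_mult smooth_on_inverse smooth_on_det)
       (auto simp: invertible_det_nz smooth_on_const intro: smooth_on_if)
qed (use assms in \<open>simp add: matrix_inv_cramer cong: if_cong\<close>)

text \<open>The left-hand side of the equation is symmetric in \<open>u\<close> and \<open>v\<close>, which gives the symmetry of
  second derivatives as \<open>s\<close> tends to 0.\<close>

lemma second_difference_mean_value:
  fixes f :: "'a::real_normed_vector \<Rightarrow> real"
  assumes s: "s > 0" "s * (norm u + norm v) < r"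
    and f: "\<And>y. y \<in> ball x r \<Longrightarrow> f differentiable (at y)"
    and f': "\<And>y. y \<in> ball x r \<Longrightarrow> (\<lambda>y. frechet_derivative f (at y) u) differentiable (at y)"
  obtains y where "dist x y \<le> s * (norm u + norm v)"
    and "f (x + s *\<^sub>R u + s *\<^sub>R v) - f (x + s *\<^sub>R u) - f (x + s *\<^sub>R v) + f x =
      s\<^sup>2 * frechet_derivative (\<lambda>y. frechet_derivative f (at y) u) (at y) v"
proof -
  \<comment> \<open>The whole parallelogram spanned by \<open>s *\<^sub>R u\<close> and
    \<open>s *\<^sub>R v\<close> at \<open>x\<close> stays in the ball, so the mean value theorem
    may be used along any segment in it.\<close>
  have dist: "dist x (x + a *\<^sub>R u + b *\<^sub>R v) \<le> s * (norm u + norm v)"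
    if "0 \<le> a" "a \<le> s" "0 \<le> b" "b \<le> s" for a b
  proof -
    have "norm (a *\<^sub>R u + b *\<^sub>R v) \<le> a * norm u + b * norm v"
      by (rule norm_triangle_le) (use that in simp)
    also have "\<dots> \<le> s * norm u + s * norm v"
      using that by (intro add_mono mult_right_mono) auto
    finally have "norm (a *\<^sub>R u + b *\<^sub>R v) \<le> s * (norm u + norm v)"
      by (simp add: distrib_left)
    moreover have "x - (x + a *\<^sub>R u + b *\<^sub>R v) = - (a *\<^sub>R u + b *\<^sub>R v)"
      by simp
    ultimately show ?thesis by (simp only: dist_norm norm_minus_cancel)
  qed
  have line: "((\<lambda>t. h (p + t *\<^sub>R w)) has_real_derivative frechet_derivative h (at (p + t *\<^sub>R w)) w) (at t)"
    if "h differentiable (at (p + t *\<^sub>R w))" for h :: "'a \<Rightarrow> real" and p w t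
  proof -
    have "((\<lambda>t. p + t *\<^sub>R w) has_derivative (\<lambda>r. r *\<^sub>R w)) (at t)"
      by (auto intro!: derivative_eq_intros)
    then have "((\<lambda>t. h (p + t *\<^sub>R w)) has_derivative
        (\<lambda>r. frechet_derivative h (at (p + t *\<^sub>R w)) (r *\<^sub>R w))) (at t)"
      by (rule has_derivative_compose) (use that in \<open>simp add: frechet_derivative_works[symmetric]\<close>)
    moreover have "(\<lambda>r. frechet_derivative h (at (p + t *\<^sub>R w)) (r *\<^sub>R w)) =
        (*) (frechet_derivative h (at (p + t *\<^sub>R w)) w)"
      using linear_frechet_derivative[OF that] by (simp add: linear_cmul fun_eq_iff)
    ultimately show ?thesis
      by (simp only: has_field_derivative_def)
  qed
  have in1: "x + a *\<^sub>R u + b *\<^sub>R v \<in> ball x r" if "0 \<le> a" "a \<le> s" "0 \<le> b" "b \<le> s" for a b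
    using dist[OF that] s(2) by simp
  \<comment> \<open>The second difference is \<open>\<phi> s - \<phi> 0\<close>. The mean value
    theorem for \<open>\<phi>\<close> differentiates in direction \<open>u\<close>; what remains is
    a difference in direction \<open>v\<close>, to which it is applied again through
    \<open>\<psi>\<close>.\<close>
  define \<phi> where "\<phi> a = f ((x + s *\<^sub>R v) + a *\<^sub>R u) - f (x + a *\<^sub>R u)" for a
  have "\<exists>a>0. a < s \<and> \<phi> s - \<phi> 0 = (s - 0) * (frechet_derivative f (at ((x + s *\<^sub>R v) + a *\<^sub>R u)) u -
        frechet_derivative f (at (x + a *\<^sub>R u)) u)"
    unfolding \<phi>_def
    using f[OF in1[of _ s]] f[OF in1[of _ 0]] s
    by (intro MVT2 DERIV_diff line) (auto simp: algebra_simps)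
  then obtain a where a: "0 < a" "a < s"
    and 1: "\<phi> s - \<phi> 0 = s * (frechet_derivative f (at ((x + a *\<^sub>R u) + s *\<^sub>R v)) u -
        frechet_derivative f (at (x + a *\<^sub>R u)) u)"
    by (auto simp: algebra_simps)
  define \<psi> where "\<psi> b = frechet_derivative f (at ((x + a *\<^sub>R u) + b *\<^sub>R v)) u" for b
  have "\<exists>b>0. b < s \<and> \<psi> s - \<psi> 0 = (s - 0) *
      frechet_derivative (\<lambda>y. frechet_derivative f (at y) u) (at ((x + a *\<^sub>R u) + b *\<^sub>R v)) v"
    unfolding \<psi>_def
    using f'[OF in1[of a]] s a
    by (intro MVT2 line) auto
  then obtain b where b: "0 < b" "b < s" and 2: "\<psi> s - \<psi> 0 = s *
      frechet_derivative (\<lambda>y. frechet_derivative f (at y) u) (at ((x + a *\<^sub>R u) + b *\<^sub>R v)) v"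
    by auto
  show ?thesis
  proof
    show "dist x (x + a *\<^sub>R u + b *\<^sub>R v) \<le> s * (norm u + norm v)"
      using a b by (intro dist) auto
    show "f (x + s *\<^sub>R u + s *\<^sub>R v) - f (x + s *\<^sub>R u) - f (x + s *\<^sub>R v) + f x =
      s\<^sup>2 * frechet_derivative (\<lambda>y. frechet_derivative f (at y) u) (at (x + a *\<^sub>R u + b *\<^sub>R v)) v"
      using 1 2 by (simp add: \<phi>_def \<psi>_def power2_eq_square algebra_simps)
  qed
qed

lemma second_frechet_derivative_commute:
  fixes f :: "'a::real_normed_vector \<Rightarrow> real"
  assumes S: "open S" "x \<in> S" and f: "smooth_on f S"
  shows "frechet_derivative (\<lambda>y. frechet_derivative f (at y) u) (at x) v =
    frechet_derivative (\<lambda>y. frechet_derivative f (at y) v) (at x) u"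
proof (rule ccontr)
  define H where "H u v y = frechet_derivative (\<lambda>y. frechet_derivative f (at y) u) (at y) v" for u v y
  assume "\<not> ?thesis"
  \<comment> \<open>Half the distance of the two mixed derivatives at \<open>x\<close>: a common
    value cannot be closer than this to both of them.\<close>
  then have e: "dist (H u v x) (H v u x) / 2 > 0" (is "?e > 0") by (simp add: H_def)
  have cont: "continuous (at x) (H u v)" for u v
    unfolding H_def using smooth_on_continuous_on[OF smooth_on_frechet_derivative[OF smooth_on_frechet_derivative[OF f]]] S
    by (simp add: continuous_on_eq_continuous_at)
  have near: "\<exists>r>0. \<forall>y. dist y x < r \<longrightarrow> dist (H u v y) (H u v x) < ?e" for u v
    using cont[of u v] e unfolding continuous_at_eps_delta by blast
  obtain r1 where r1: "r1 > 0" "\<And>y. dist y x < r1 \<Longrightarrow> dist (H u v y) (H u v x) < ?e"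
    using near[of u v] by blast
  obtain r2 where r2: "r2 > 0" "\<And>y. dist y x < r2 \<Longrightarrow> dist (H v u y) (H v u x) < ?e"
    using near[of v u] by blast
  obtain r3 where r3: "r3 > 0" "ball x r3 \<subseteq> S"
    using S open_contains_ball by blast
  define r where "r = Min {r1, r2, r3}"
  have r: "r > 0" "r \<le> r1" "r \<le> r2" "ball x r \<subseteq> S"
    using r1(1) r2(1) r3 by (auto simp: r_def)
  \<comment> \<open>The summand 1 keeps the denominator positive when \<open>u\<close> and
    \<open>v\<close> are both 0, and makes the bound by \<open>r\<close> strict.\<close>
  define s where "s = r / (norm u + norm v + 1)"
  have pos: "norm u + norm v + 1 > 0" by (simp add: add_nonneg_pos)
  have s: "s > 0" "s * (norm u + norm v) < r"
    using r(1) pos by (simp_all add: s_def pos_divide_less_eq)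
  have s': "s * (norm v + norm u) < r" using s by (simp add: add.commute)
  have df: "f differentiable (at y)" if "y \<in> ball x r" for y
    using smooth_on_differentiable[OF f] that r(4) by auto
  have df': "(\<lambda>y. frechet_derivative f (at y) w) differentiable (at y)" if "y \<in> ball x r" for y w
    using smooth_on_differentiable[OF smooth_on_frechet_derivative[OF f]] that r(4) by auto
  obtain y where y: "dist x y \<le> s * (norm u + norm v)"
    "f (x + s *\<^sub>R u + s *\<^sub>R v) - f (x + s *\<^sub>R u) - f (x + s *\<^sub>R v) + f x = s\<^sup>2 * H u v y"
    unfolding H_def by (rule second_difference_mean_value[OF s df df'])
  obtain y' where y': "dist x y' \<le> s * (norm v + norm u)"
    "f (x + s *\<^sub>R v + s *\<^sub>R u) - f (x + s *\<^sub>R v) - f (x + s *\<^sub>R u) + f x = s\<^sup>2 * H v u y'"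
    unfolding H_def by (rule second_difference_mean_value[OF s(1) s' df df'])
  \<comment> \<open>Both second differences are the same number, so the mixed derivatives coincide,
    though at the different points \<open>y\<close> and \<open>y'\<close>; both points are close to
    \<open>x\<close>.\<close>
  have swap: "x + s *\<^sub>R v + s *\<^sub>R u = x + s *\<^sub>R u + s *\<^sub>R v"
    by simp
  have "s\<^sup>2 * H u v y = s\<^sup>2 * H v u y'"
    using y(2) y'(2) unfolding swap by linarith
  then have eq: "H u v y = H v u y'" using s(1) by simp
  have "dist y x < r1" "dist y' x < r2"
    using y(1) y'(1) s(2) s' r by (simp_all add: dist_commute)
  then have "dist (H u v y) (H u v x) < ?e" "dist (H v u y') (H v u x) < ?e"
    using r1(2) r2(2) by blast+
  moreover have "dist (H u v x) (H v u x) \<le> dist (H u v y) (H u v x) + dist (H v u y') (H v u x)"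
    unfolding eq by (rule dist_triangle3)
  ultimately show False by linarith
qed

section \<open>Dual frames and their Weitzenboeck coefficients\<close>

text \<open>The operators \<^const>\<open>dy\<close> and \<^const>\<open>delta\<close> are both derivatives along a system of
  tangent vectors at the point, so the h-part and the v-part can be treated at once.\<close>

locale derivation_at =
  fixes d :: "'n::finite \<Rightarrow> ('n point \<Rightarrow> real) \<Rightarrow> 'n point \<Rightarrow> real"
    and X :: "'n \<Rightarrow> 'n point" and z :: "'n point"
  assumes along: "f differentiable (at z) \<Longrightarrow> d n f z = frechet_derivative f (at z) (X n)"
begin

lemma has_derivative: "(f has_derivative f') (at z) \<Longrightarrow> d n f z = f' (X n)"
  by (simp add: along[OF differentiableI] frechet_derivative_eqI)

lemma const: "d n (\<lambda>w. k) z = 0"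
  by (rule has_derivative[OF has_derivative_const])

lemma mult:
  "f differentiable (at z) \<Longrightarrow> g differentiable (at z) \<Longrightarrow>
    d n (\<lambda>w. f w * g w) z = f z * d n g z + d n f z * g z"
  unfolding frechet_derivative_works
  by (simp add: has_derivative[OF has_derivative_mult] has_derivative)

lemma sum:
  "(\<And>i. f i differentiable (at z)) \<Longrightarrow> d n (\<lambda>w. \<Sum>i\<in>I. f i w) z = (\<Sum>i\<in>I. d n (f i) z)"
  using has_derivative[OF has_derivative_sum, of I f "\<lambda>i. frechet_derivative (f i) (at z)" n]
  by (simp add: frechet_derivative_works[symmetric] along)

text \<open>The identities between frames hold only on coordinate domains, and are differentiated by
  means of this lemma. As \<open>along\<close> speaks of differentiable functions only,
  \<open>g\<close> has to inherit differentiability from \<open>f\<close> first.\<close>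

lemma cong:
  "f differentiable (at z) \<Longrightarrow> open S \<Longrightarrow> z \<in> S \<Longrightarrow> (\<And>w. w \<in> S \<Longrightarrow> f w = g w) \<Longrightarrow> d n f z = d n g z"
proof -
  assume f: "f differentiable (at z)" and S: "open S" "z \<in> S" and eq: "\<And>w. w \<in> S \<Longrightarrow> f w = g w"
  have "(f has_derivative frechet_derivative f (at z)) (at z)"
    using f by (simp add: frechet_derivative_works[symmetric])
  then have "(g has_derivative frechet_derivative f (at z)) (at z)"
    using S eq by (rule has_derivative_transform_within_open)
  then show ?thesis
    by (simp add: has_derivative along[OF f])
qed

end

lemma derivation_at_dy: "derivation_at dy (\<lambda>n. (0, axis n 1)) z"
  by unfold_locales (simp add: dy_def)

lemma derivation_at_delta: "derivation_at (delta N) (\<lambda>n. (axis n 1, - (\<chi> a. N z a n))) z"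
proof
  fix f :: "'a point \<Rightarrow> real" and n
  assume "f differentiable (at z)"
  then interpret linear "frechet_derivative f (at z)"
    by (rule linear_frechet_derivative)
  \<comment> \<open>This vector is the horizontal lift of the coordinate vector; expanding it in the
    coordinate directions turns linearity of the derivative into the definition of
    \<open>delta\<close>.\<close>
  have "(axis n 1, - (\<chi> a. N z a n)) = (axis n 1, 0) - (\<Sum>a\<in>UNIV. N z a n *\<^sub>R ((0, axis a 1) :: 'a point))"
    by (auto simp: prod_eq_iff fst_sum snd_sum vec_eq_iff axis_def if_distrib cong: if_cong)
  then show "delta N n f z = frechet_derivative f (at z) (axis n 1, - (\<chi> a. N z a n))"
    by (simp add: delta_def dx_def dy_def diff sum scale del: scaleR_Pair)
qed

text \<open>The coefficients of the teleparallel connection of the frame \<open>f\<close> with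
  coframe \<open>h\<close>. The operator \<open>d\<close> is left open so that the h-part and the
  v-part are two instances.\<close>

definition weitzenboeck ::
  "('n::finite \<Rightarrow> ('n point \<Rightarrow> real) \<Rightarrow> 'n point \<Rightarrow> real) \<Rightarrow> ('n point \<Rightarrow> 'n \<Rightarrow> 'n \<Rightarrow> real) \<Rightarrow>
   ('n point \<Rightarrow> 'n \<Rightarrow> 'n \<Rightarrow> real) \<Rightarrow> 'n point \<Rightarrow> 'n \<Rightarrow> 'n \<Rightarrow> 'n \<Rightarrow> real" where
  "weitzenboeck d f h z a m n = (\<Sum>i\<in>UNIV. f z i a * d n (\<lambda>w. h w i m) z)"

text \<open>After an exchange of the sums the inner one is a Kronecker delta. This serves for frame
  against coframe and for a Jacobian against its inverse.\<close>

lemma sum_contract: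
  fixes F G :: "'i::finite \<Rightarrow> 'n::finite \<Rightarrow> real"
  assumes "\<And>a b. (\<Sum>i\<in>UNIV. F i a * G i b) = (if a = b then 1 else 0)"
  shows "(\<Sum>i\<in>UNIV. F i a * (\<Sum>b\<in>UNIV. G i b * T b)) = T a" (is "?L = _")
    and "(\<Sum>i\<in>UNIV. F i a * (\<Sum>b\<in>UNIV. T b * G i b)) = T a"
proof -
  have "?L = (\<Sum>b\<in>UNIV. (\<Sum>i\<in>UNIV. F i a * G i b) * T b)"
    unfolding sum_distrib_left sum_distrib_right mult.assoc by (rule sum.swap)
  then show *: "?L = T a"
    by (simp add: assms if_distrib[of "\<lambda>x. x * _"] cong: if_cong)
  show "(\<Sum>i\<in>UNIV. F i a * (\<Sum>b\<in>UNIV. T b * G i b)) = T a"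
    using * by (simp only: mult.commute[of "T _"])
qed

text \<open>By duality, the frame contracted with the connection term of the covariant derivative
  gives back \<open>G\<close>, which cancels the first summand and leaves the derivative term
  alone.\<close>

lemma weitzenboeck_eq_plus_contortion:
  assumes "\<And>a b. (\<Sum>i\<in>UNIV. f z i a * h z i b) = (if a = b then 1 else 0)"
  shows "weitzenboeck d f h z a m n =
    G z a m n + (\<Sum>i\<in>UNIV. f z i a * cov_covector d G (\<lambda>w. h w i) z m n)"
  using sum_contract(1)[of "f z" "h z" a "\<lambda>e. G z e m n", OF assms]
  by (simp add: weitzenboeck_def cov_covector_def right_diff_distrib sum_subtractf)

text \<open>Duality is stated on a neighbourhood of \<open>z\<close>, since it is going to be
  differentiated there.\<close>

locale dual_frames = derivation_at d X z
  for d :: "'n::finite \<Rightarrow> ('n point \<Rightarrow> real) \<Rightarrow> 'n point \<Rightarrow> real" and X z +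
  fixes f h :: "'n point \<Rightarrow> 'n \<Rightarrow> 'n \<Rightarrow> real" and S :: "'n point set"
  assumes S: "open S" "z \<in> S"
    and frame: "(\<lambda>w. f w i a) differentiable (at z)"
    and coframe: "(\<lambda>w. h w i a) differentiable (at z)"
    and dual: "w \<in> S \<Longrightarrow> (\<Sum>a\<in>UNIV. f w i a * h w j a) = (if i = j then 1 else 0)"
    and dual': "w \<in> S \<Longrightarrow> (\<Sum>i\<in>UNIV. f w i a * h w i b) = (if a = b then 1 else 0)"
begin

text \<open>Differentiating the duality relation moves the derivative from the coframe to the frame
  at the price of a sign. Contraction with the frame then yields minus the derivative of the frame
  vector, which cancels the first term of the covariant derivative.\<close>

lemma weitzenboeck_parallel: "cov_vector d (weitzenboeck d f h) (\<lambda>w. f w i) z a n = 0"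
proof -
  have pair: "(\<Sum>e\<in>UNIV. f z i e * d n (\<lambda>w. h w j e) z) = - (\<Sum>e\<in>UNIV. d n (\<lambda>w. f w i e) z * h z j e)" for j
  proof -
    have "d n (\<lambda>w. \<Sum>e\<in>UNIV. f w i e * h w j e) z = d n (\<lambda>w. if i = j then 1 else 0) z"
      using frame coframe S dual by (intro cong[of _ S]) (auto intro!: differentiable_sum differentiable_mult)
    then show ?thesis
      using frame coframe by (simp add: const sum mult differentiable_mult sum.distrib eq_neg_iff_add_eq_0)
  qed
  have "(\<Sum>e\<in>UNIV. f z i e * weitzenboeck d f h z a e n) =
      (\<Sum>j\<in>UNIV. f z j a * (\<Sum>e\<in>UNIV. f z i e * d n (\<lambda>w. h w j e) z))"
    unfolding weitzenboeck_def sum_distrib_left by (subst sum.swap) (simp add: ac_simps)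
  also have "\<dots> = - d n (\<lambda>w. f w i a) z"
    using sum_contract(2)[of "f z" "h z" a "\<lambda>e. d n (\<lambda>w. f w i e) z"] dual' S
    by (simp add: pair sum_negf)
  finally show ?thesis
    by (simp add: cov_vector_def)
qed

text \<open>Parallelism prescribes the contraction of \<open>G\<close> with every frame vector;
  contracting with the coframe recovers \<open>G\<close> from these.\<close>

lemma weitzenboeck_unique:
  assumes "\<And>i a n. cov_vector d G (\<lambda>w. f w i) z a n = 0"
  shows "G z a m n = weitzenboeck d f h z a m n"
proof -
  have "(\<Sum>e\<in>UNIV. f z i e * G z a e n) = (\<Sum>e\<in>UNIV. f z i e * weitzenboeck d f h z a e n)" for i
    using assms[of i a n] weitzenboeck_parallel[of i a n] by (simp add: cov_vector_def)
  moreover have "(\<Sum>i\<in>UNIV. h z i m * (\<Sum>e\<in>UNIV. f z i e * T e)) = T m" for T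
    using dual'[OF S(2)] by (intro sum_contract(1)) (auto simp: mult.commute[of "h z _ _"])
  from this[of "\<lambda>e. G z a e n"] this[of "\<lambda>e. weitzenboeck d f h z a e n"] calculation
  show ?thesis by simp
qed

text \<open>Contracting the upper index of the coefficients with the coframe gives the derivative of
  the coframe. Hence each of the two connection terms is one of the two terms of the product rule
  for the metric.\<close>

lemma weitzenboeck_metrical:
  "cov_tensor_0_2 d (weitzenboeck d f h) (\<lambda>w m n. \<Sum>i\<in>UNIV. h w i m * h w i n) z m n s = 0"
proof -
  have lower: "(\<Sum>e\<in>UNIV. (\<Sum>i\<in>UNIV. h z i e * h z i p) * weitzenboeck d f h z e q s) =
      (\<Sum>i\<in>UNIV. h z i p * d s (\<lambda>w. h w i q) z)" for p q
  proof -
    have contract: "(\<Sum>e\<in>UNIV. h z i e * weitzenboeck d f h z e q s) = d s (\<lambda>w. h w i q) z" for i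
      unfolding weitzenboeck_def using dual[OF S(2)]
      by (intro sum_contract(1)[of "\<lambda>e i. h z i e" "\<lambda>e j. f z j e"]) (auto simp: mult.commute[of "h z _ _"])
    have "(\<Sum>e\<in>UNIV. (\<Sum>i\<in>UNIV. h z i e * h z i p) * weitzenboeck d f h z e q s) =
        (\<Sum>i\<in>UNIV. h z i p * (\<Sum>e\<in>UNIV. h z i e * weitzenboeck d f h z e q s))"
      unfolding sum_distrib_right sum_distrib_left by (subst sum.swap) (simp add: ac_simps)
    then show ?thesis by (simp only: contract)
  qed
  have "d s (\<lambda>w. \<Sum>i\<in>UNIV. h w i m * h w i n) z =
      (\<Sum>i\<in>UNIV. h z i m * d s (\<lambda>w. h w i n) z) + (\<Sum>i\<in>UNIV. h z i n * d s (\<lambda>w. h w i m) z)"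
    using coframe by (simp add: sum mult differentiable_mult sum.distrib mult.commute)
  moreover have sym: "(\<Sum>i\<in>UNIV. h z i m * h z i e) = (\<Sum>i\<in>UNIV. h z i e * h z i m)" for e
    by (simp only: mult.commute)
  ultimately show ?thesis
    using lower[of n m] lower[of m n] by (simp only: cov_tensor_0_2_def sym)
qed

text \<open>The change of chart in abstract form: \<Phi> leads from the primed to the unprimed
  coordinates, \<open>P\<close> is its Jacobian as a function, and \<open>Q\<close> stands for the
  Jacobian of the opposite change at the point. In the derivative of the law of the coframe, the
  chain rule for \<open>h\<close> produces the tensorial part and the derivative of \<open>P\<close>
  the inhomogeneous one.\<close>

lemma weitzenboeck_transform:
  assumes "derivation_at d' X' z'" and W: "open W" "z' \<in> W" and \<Phi>: "(\<Phi> has_derivative D\<Phi>) (at z')" "\<Phi> z' = z"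
    and X': "\<And>n'. D\<Phi> (X' n') = (\<Sum>n\<in>UNIV. P z' n n' *\<^sub>R X n)"
    and P: "\<And>m m'. (\<lambda>w. P w m m') differentiable (at z')"
    and f': "\<And>i a'. f' z' i a' = (\<Sum>a\<in>UNIV. Q a' a * f z i a)"
    and h': "\<And>w i m'. w \<in> W \<Longrightarrow> h' w i m' = (\<Sum>m\<in>UNIV. P w m m' * h (\<Phi> w) i m)"
  shows "weitzenboeck d' f' h' z' a' m' n' =
    (\<Sum>a\<in>UNIV. \<Sum>m\<in>UNIV. \<Sum>n\<in>UNIV. Q a' a * P z' m m' * P z' n n' * weitzenboeck d f h z a m n) +
    (\<Sum>e\<in>UNIV. Q a' e * d' n' (\<lambda>w. P w e m') z')"
proof -
  interpret d': derivation_at d' X' z' by fact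
  have hd: "((\<lambda>w. h (\<Phi> w) i m) has_derivative (\<lambda>v. frechet_derivative (\<lambda>w. h w i m) (at z) (D\<Phi> v))) (at z')" for i m
    using has_derivative_compose[OF \<Phi>(1), of "\<lambda>w. h w i m" "frechet_derivative (\<lambda>w. h w i m) (at z)"]
      coframe[of i m] \<Phi>(2) by (simp add: frechet_derivative_works[symmetric])
  then have diff: "(\<lambda>w. h (\<Phi> w) i m) differentiable (at z')" for i m
    by (rule differentiableI)
  \<comment> \<open>By the chain rule the derivative is taken along \<open>D\<Phi> (X' n')\<close>,
    which \<open>X'\<close> expresses through the vectors \<open>X n\<close>.\<close>
  have dh: "d' n' (\<lambda>w. h (\<Phi> w) i m) z' = (\<Sum>n\<in>UNIV. P z' n n' * d n (\<lambda>w. h w i m) z)" for i m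
  proof -
    interpret D: linear "frechet_derivative (\<lambda>w. h w i m) (at z)"
      using coframe by (rule linear_frechet_derivative)
    show ?thesis
      by (simp add: d'.has_derivative[OF hd] X' D.sum D.scale along[OF coframe])
  qed
  have dh': "d' n' (\<lambda>w. h' w i m') z' =
      (\<Sum>m\<in>UNIV. \<Sum>n\<in>UNIV. P z' m m' * P z' n n' * d n (\<lambda>w. h w i m) z) +
      (\<Sum>m\<in>UNIV. h z i m * d' n' (\<lambda>w. P w m m') z')" for i
  proof -
    have "d' n' (\<lambda>w. h' w i m') z' = d' n' (\<lambda>w. \<Sum>m\<in>UNIV. P w m m' * h (\<Phi> w) i m) z'"
      by (rule d'.cong[OF _ W, symmetric]) (use h' P diff in \<open>auto intro!: differentiable_sum differentiable_mult\<close>)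
    also have "\<dots> = (\<Sum>m\<in>UNIV. P z' m m' * (\<Sum>n\<in>UNIV. P z' n n' * d n (\<lambda>w. h w i m) z) +
        d' n' (\<lambda>w. P w m m') z' * h z i m)"
      using P diff by (simp add: d'.sum d'.mult differentiable_mult dh \<Phi>(2))
    finally show ?thesis
      by (simp add: sum.distrib sum_distrib_left mult.assoc mult.commute[of "h z i _"])
  qed
  have "weitzenboeck d' f' h' z' a' m' n' =
     (\<Sum>i\<in>UNIV. (\<Sum>a\<in>UNIV. Q a' a * f z i a) *
        (\<Sum>m\<in>UNIV. \<Sum>n\<in>UNIV. P z' m m' * P z' n n' * d n (\<lambda>w. h w i m) z)) +
     (\<Sum>i\<in>UNIV. (\<Sum>a\<in>UNIV. Q a' a * f z i a) * (\<Sum>m\<in>UNIV. h z i m * d' n' (\<lambda>w. P w m m') z'))"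
    by (simp add: weitzenboeck_def f' dh' distrib_left sum.distrib)
  also have "(\<Sum>i\<in>UNIV. (\<Sum>a\<in>UNIV. Q a' a * f z i a) * (\<Sum>m\<in>UNIV. h z i m * d' n' (\<lambda>w. P w m m') z')) =
     (\<Sum>a\<in>UNIV. Q a' a * (\<Sum>i\<in>UNIV. f z i a * (\<Sum>m\<in>UNIV. h z i m * d' n' (\<lambda>w. P w m m') z')))"
    by (simp add: sum_distrib_right sum_distrib_left[of "Q _ _"] mult.assoc) (rule sum.swap)
  also have "\<dots> = (\<Sum>e\<in>UNIV. Q a' e * d' n' (\<lambda>w. P w e m') z')"
    using dual'[OF S(2)] by (simp add: sum_contract(1)[of "f z" "h z"])
  also have "(\<Sum>i\<in>UNIV. (\<Sum>a\<in>UNIV. Q a' a * f z i a) *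
        (\<Sum>m\<in>UNIV. \<Sum>n\<in>UNIV. P z' m m' * P z' n n' * d n (\<lambda>w. h w i m) z)) =
     (\<Sum>i\<in>UNIV. \<Sum>a\<in>UNIV. \<Sum>m\<in>UNIV. \<Sum>n\<in>UNIV.
        Q a' a * P z' m m' * P z' n n' * (f z i a * d n (\<lambda>w. h w i m) z))"
    unfolding sum_distrib_right by (simp add: sum_distrib_left ac_simps)
  \<comment> \<open>The sum over the frame index is moved inwards past the other three, where it
    forms the coefficients in the unprimed chart.\<close>
  also have "\<dots> = (\<Sum>a\<in>UNIV. \<Sum>m\<in>UNIV. \<Sum>n\<in>UNIV. \<Sum>i\<in>UNIV.
        Q a' a * P z' m m' * P z' n n' * (f z i a * d n (\<lambda>w. h w i m) z))"
    by (subst sum.swap, rule sum.cong[OF refl], subst sum.swap, rule sum.cong[OF refl], rule sum.swap)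
  also have "\<dots> = (\<Sum>a\<in>UNIV. \<Sum>m\<in>UNIV. \<Sum>n\<in>UNIV. Q a' a * P z' m m' * P z' n n' * weitzenboeck d f h z a m n)"
    by (simp add: weitzenboeck_def sum_distrib_left)
  finally show ?thesis .
qed

end

section \<open>Charts of the tangent bundle\<close>

lemma has_derivative_vec_lambda:
  fixes f :: "'a::real_normed_vector \<Rightarrow> 'n::finite \<Rightarrow> real"
  assumes "\<And>i. ((\<lambda>x. f x i) has_derivative (\<lambda>v. f' v i)) (at x within S)"
  shows "((\<lambda>x. \<chi> i. f x i) has_derivative (\<lambda>v. \<chi> i. f' v i)) (at x within S)"
  using assms by (subst has_derivative_componentwise_within) (auto simp: Basis_vec_def inner_axis)

definition jac_apply :: "('m, 'n::finite) chart \<Rightarrow> ('m, 'n) chart \<Rightarrow> real ^ 'n \<Rightarrow> real ^ 'n \<Rightarrow> real ^ 'n" where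
  "jac_apply c c' x v = (\<chi> a'. \<Sum>a\<in>UNIV. jac c c' x a' a * v $ a)"

locale smooth_atlas =
  fixes X :: "'m topology" and A :: "('m, 'n::finite) chart set"
  assumes manifold: "smooth_manifold X A"
begin

lemma openin_chart: "c \<in> A \<Longrightarrow> openin X (fst c)"
  and open_chart: "c \<in> A \<Longrightarrow> open (snd c ` fst c)"
  and homeomorphic_chart:
    "c \<in> A \<Longrightarrow> homeomorphic_map (subtopology X (fst c)) (top_of_set (snd c ` fst c)) (snd c)"
  and smooth_transition:
    "c \<in> A \<Longrightarrow> c' \<in> A \<Longrightarrow> smooth_on (transition c c') (snd c ` (fst c \<inter> fst c'))"
  using manifold by (auto simp: smooth_manifold_def)

lemma inj_on_chart: "c \<in> A \<Longrightarrow> inj_on (snd c) (fst c)"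
  using homeomorphic_imp_injective_map[OF homeomorphic_chart] openin_chart[THEN openin_subset]
  by (simp add: inf.absorb2)

text \<open>A chart is an open map onto an open set, so relative openness of the image is openness.
  With a general \<open>V\<close> this covers triple overlaps as well.\<close>

lemma open_overlap:
  assumes "c \<in> A" "openin X V"
  shows "open (snd c ` (fst c \<inter> V))"
proof -
  have "openin (subtopology X (fst c)) (fst c \<inter> V)"
    using assms by (simp add: openin_subtopology_Int2)
  then have "openin (top_of_set (snd c ` fst c)) (snd c ` (fst c \<inter> V))"
    using homeomorphic_imp_open_map[OF homeomorphic_chart[OF assms(1)]] by (simp add: open_map_def)
  then show ?thesis
    using open_chart[OF assms(1)] openin_open_eq by blast
qed

lemma transition_chart: "c \<in> A \<Longrightarrow> p \<in> fst c \<Longrightarrow> transition c c' (snd c p) = snd c' p"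
  by (simp add: transition_def inv_into_f_f[OF inj_on_chart])

lemma transition_component_smooth:
  assumes "c \<in> A" "c' \<in> A"
  shows "smooth_on (\<lambda>x. transition c c' x $ a) (snd c ` (fst c \<inter> fst c'))"
  using smooth_on_bounded_linear[OF bounded_linear_vec_nth open_overlap smooth_transition] openin_chart assms
  by blast

lemma jac_smooth:
  "c \<in> A \<Longrightarrow> c' \<in> A \<Longrightarrow> smooth_on (\<lambda>x. jac c c' x a' a) (snd c ` (fst c \<inter> fst c'))"
  unfolding jac_def by (rule smooth_on_frechet_derivative[OF transition_component_smooth])

lemma hess_commute:
  assumes "c \<in> A" "c' \<in> A" "p \<in> fst c" "p \<in> fst c'"
  shows "hess c c' (snd c p) a m n = hess c c' (snd c p) a n m"
  unfolding hess_def jac_def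
  using assms
  by (intro second_frechet_derivative_commute[OF open_overlap _ transition_component_smooth] openin_chart) auto

text \<open>The entries of \<open>jac\<close> are partial derivatives of components; expansion in
  the standard basis assembles them into the total derivative, for which the chain rule is
  available.\<close>

lemma transition_has_derivative:
  assumes "c \<in> A" "c' \<in> A" "p \<in> fst c" "p \<in> fst c'"
  shows "(transition c c' has_derivative jac_apply c c' (snd c p)) (at (snd c p))"
proof -
  let ?D = "frechet_derivative (transition c c') (at (snd c p))"
  have diff: "transition c c' differentiable at (snd c p)"
    using smooth_on_differentiable[OF smooth_transition[OF assms(1,2)]] assms by blast
  then have D: "(transition c c' has_derivative ?D) (at (snd c p))"
    by (simp add: frechet_derivative_works[symmetric])
  have jac: "jac c c' (snd c p) a' a = ?D (axis a 1) $ a'" for a' a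
    unfolding jac_def
    using frechet_derivative_eqI[OF bounded_linear.has_derivative[OF bounded_linear_vec_nth D]] by simp
  interpret linear ?D using diff by (rule linear_frechet_derivative)
  have "?D v = jac_apply c c' (snd c p) v" for v
  proof -
    have "?D v = ?D (\<Sum>a\<in>UNIV. v $ a *\<^sub>R axis a 1)"
      by (simp add: basis_expansion[of v, unfolded scalar_mult_eq_scaleR])
    then show ?thesis
      by (simp add: sum scale vec_eq_iff jac_apply_def jac mult.commute)
  qed
  then show ?thesis using D by (metis ext)
qed

text \<open>The cocycle law: near the point the composite of two transition maps is the third, so
  the chain rule and the uniqueness of derivatives give the equation.\<close>

lemma jac_apply_comp:
  assumes A: "c \<in> A" "c' \<in> A" "c'' \<in> A" and p: "p \<in> fst c" "p \<in> fst c'" "p \<in> fst c''"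
  shows "jac_apply c' c'' (snd c' p) (jac_apply c c' (snd c p) v) = jac_apply c c'' (snd c p) v"
proof -
  have d: "((\<lambda>x. transition c' c'' (transition c c' x)) has_derivative
      (\<lambda>v. jac_apply c' c'' (snd c' p) (jac_apply c c' (snd c p) v))) (at (snd c p))"
    using has_derivative_compose[OF transition_has_derivative, of c c' p "transition c' c''" "jac_apply c' c'' (snd c' p)"]
      transition_has_derivative[of c' c'' p] A p
    by (simp add: transition_chart)
  have eq: "transition c' c'' (transition c c' x) = transition c c'' x"
    if "x \<in> snd c ` (fst c \<inter> (fst c' \<inter> fst c''))" for x
    using that A by (auto simp: transition_chart)
  have "(transition c c'' has_derivative
      (\<lambda>v. jac_apply c' c'' (snd c' p) (jac_apply c c' (snd c p) v))) (at (snd c p))"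
    by (rule has_derivative_transform_within_open[OF d _ _ eq])
       (use A p in \<open>auto intro!: open_overlap openin_Int openin_chart\<close>)
  from has_derivative_unique[OF this transition_has_derivative] A p show ?thesis
    by metis
qed

lemma jac_apply_same:
  assumes "c \<in> A" "p \<in> fst c"
  shows "jac_apply c c (snd c p) v = v"
proof -
  have "(transition c c has_derivative (\<lambda>v. v)) (at (snd c p))"
    by (rule has_derivative_transform_within_open[OF has_derivative_ident open_chart])
       (use assms in \<open>auto simp: transition_chart\<close>)
  from has_derivative_unique[OF this transition_has_derivative] assms show ?thesis
    by metis
qed

lemma jac_mult_jac:
  assumes "c \<in> A" "c' \<in> A" "p \<in> fst c" "p \<in> fst c'"
  shows "(\<Sum>b\<in>UNIV. jac c' c (snd c' p) a b * jac c c' (snd c p) b a') = (if a = a' then 1 else 0)"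
proof -
  have "jac_apply c' c (snd c' p) (jac_apply c c' (snd c p) (axis a' 1)) $ a = axis a' 1 $ a"
    using assms by (simp add: jac_apply_comp jac_apply_same)
  then show ?thesis
    by (simp add: jac_apply_def axis_def if_distrib[of "\<lambda>x. _ * x"] eq_commute cong: if_cong)
qed

section \<open>Induced charts of the tangent bundle\<close>

definition over :: "('m, 'n) chart \<Rightarrow> ('m, 'n) tangent set" where
  "over c = {u \<in> tangent_bundle A. fst u \<in> fst c}"

lemma tangent_bundle_iff:
  "(p, v) \<in> tangent_bundle A \<longleftrightarrow> p \<in> \<Union> (fst ` A) \<and>
     (\<forall>c\<in>A. \<forall>c'\<in>A. p \<in> fst c \<inter> fst c' \<longrightarrow> v c' = jac_apply c c' (snd c p) (v c)) \<and>
     (\<forall>c. \<not> (c \<in> A \<and> p \<in> fst c) \<longrightarrow> v c = 0)"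
  by (simp add: tangent_bundle_def jac_apply_def vec_eq_iff)

lemma tangent_change:
  assumes "u \<in> over c" "u \<in> over c'" "c \<in> A" "c' \<in> A"
  shows "snd u c' = jac_apply c c' (snd c (fst u)) (snd u c)"
  using assms tangent_bundle_iff[of "fst u" "snd u"] unfolding over_def prod.collapse by blast

text \<open>The chart determines the base point, the component vector in \<open>c\<close> determines
  those in the other charts around it through the Jacobians, and the default value 0 fixes the rest
  of the family.\<close>

lemma inj_on_tcoords:
  assumes "c \<in> A"
  shows "inj_on (tcoords c) (over c)"
proof (rule inj_onI)
  fix u w
  assume u: "u \<in> over c" and w: "w \<in> over c" and eq: "tcoords c u = tcoords c w"
  have p: "fst u = fst w"
    using u w eq inj_on_chart[OF assms] by (auto simp: over_def tcoords_def dest: inj_onD)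
  have "snd u c' = snd w c'" for c'
  proof (cases "c' \<in> A \<and> fst u \<in> fst c'")
    case True
    then have "u \<in> over c'" "w \<in> over c'" using u w p by (auto simp: over_def)
    then have "snd u c' = jac_apply c c' (snd c (fst u)) (snd u c)"
      "snd w c' = jac_apply c c' (snd c (fst w)) (snd w c)"
      using tangent_change[of u c c'] tangent_change[of w c c'] u w True assms by blast+
    with eq p show ?thesis by (simp add: tcoords_def)
  next
    case False
    have "snd t c' = 0" if "t \<in> over c" "fst t = fst u" for t
      using that False tangent_bundle_iff[of "fst t" "snd t"] unfolding over_def prod.collapse mem_Collect_eq
      by metis
    then show ?thesis using u w p by simp
  qed
  with p show "u = w" by (simp add: prod_eq_iff fun_eq_iff)
qed

text \<open>Surjectivity rests on the cocycle law of the Jacobians: a component vector in one chart extends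
  to a compatible family.\<close>

lemma tdom_eq:
  assumes "c \<in> A"
  shows "tdom c = tcoords c ` over c"
proof
  show "tcoords c ` over c \<subseteq> tdom c"
    by (auto simp: tdom_def tcoords_def over_def)
  show "tdom c \<subseteq> tcoords c ` over c"
  proof
    fix z assume "z \<in> tdom c"
    then obtain p y where z: "z = (snd c p, y)" and p: "p \<in> fst c"
      by (auto simp: tdom_def)
    define v where "v c' = (if c' \<in> A \<and> p \<in> fst c' then jac_apply c c' (snd c p) y else 0)" for c'
    have "(p, v) \<in> tangent_bundle A"
      using assms p by (auto simp: tangent_bundle_iff v_def jac_apply_comp)
    moreover have "tcoords c (p, v) = z"
      using assms p by (simp add: tcoords_def v_def z jac_apply_same)
    ultimately show "z \<in> tcoords c ` over c"
      using p by (force simp: over_def)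
  qed
qed

lemma components_tcoords:
  assumes "c \<in> A" "u \<in> over c"
  shows "components A s c (tcoords c u) a = snd (s u) c $ a"
  using inv_into_f_f[OF inj_on_tcoords[OF assms(1)] assms(2)] by (simp add: components_def over_def)

lemma components_change:
  assumes "pullback_section A s" "c \<in> A" "c' \<in> A" "u \<in> over c" "u \<in> over c'"
  shows "components A s c' (tcoords c' u) a' =
    (\<Sum>a\<in>UNIV. jac c c' (snd c (fst u)) a' a * components A s c (tcoords c u) a)"
proof -
  have "s u \<in> over c" "s u \<in> over c'" "fst (s u) = fst u"
    using assms by (auto simp: pullback_section_def over_def)
  then show ?thesis
    using assms tangent_change[of "s u" c c'] by (simp add: components_tcoords jac_apply_def)
qed

section \<open>Changes of induced coordinates and their derivatives\<close>

lemma open_tdom: "c \<in> A \<Longrightarrow> open (tdom c)"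
  by (simp add: tdom_def open_Times open_chart)

text \<open>Written in coordinates, and not as a composite through the bundle, so that it can be
  differentiated.\<close>

definition tchange :: "('m, 'n) chart \<Rightarrow> ('m, 'n) chart \<Rightarrow> 'n point \<Rightarrow> 'n point" where
  "tchange c c' z = (transition c c' (fst z), jac_apply c c' (fst z) (snd z))"

lemma tchange_tcoords:
  "c \<in> A \<Longrightarrow> c' \<in> A \<Longrightarrow> u \<in> over c \<Longrightarrow> u \<in> over c' \<Longrightarrow> tchange c c' (tcoords c u) = tcoords c' u"
  using tangent_change[of u c c'] by (auto simp: tchange_def tcoords_def transition_chart over_def)

text \<open>By \<open>tdom_eq\<close> every component vector occurs over every base point of the
  chart, so restricting to an overlap restricts the base coordinates only.\<close>

lemma tcoords_overlap:
  assumes "c \<in> A"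
  shows "tcoords c ` (over c \<inter> over c') = snd c ` (fst c \<inter> fst c') \<times> UNIV"
proof -
  have "u \<in> over c' \<longleftrightarrow> fst (tcoords c u) \<in> snd c ` (fst c \<inter> fst c')" if "u \<in> over c" for u
    using that inj_on_image_mem_iff[OF inj_on_chart[OF assms], of "fst u" "fst c \<inter> fst c'"]
    by (auto simp: over_def tcoords_def)
  then have "tcoords c ` (over c \<inter> over c') = {z \<in> tcoords c ` over c. fst z \<in> snd c ` (fst c \<inter> fst c')}"
    by blast
  also have "\<dots> = snd c ` (fst c \<inter> fst c') \<times> UNIV"
    by (auto simp: tdom_eq[OF assms, symmetric] tdom_def)
  finally show ?thesis .
qed

lemma open_tcoords_overlap:
  "c \<in> A \<Longrightarrow> c' \<in> A \<Longrightarrow> open (tcoords c ` (over c \<inter> over c'))"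
  by (simp add: tcoords_overlap open_Times open_overlap openin_chart)

lemma jac_differentiable:
  assumes "c \<in> A" "c' \<in> A" "u \<in> over c" "u \<in> over c'"
  shows "(\<lambda>x. jac c c' x a' a) differentiable (at (fst (tcoords c u)))"
  using smooth_on_differentiable[OF jac_smooth[OF assms(1,2)]] assms(3,4)
  by (auto simp: tcoords_def over_def)

lemma jac_fst_has_derivative:
  assumes "c \<in> A" "c' \<in> A" "u \<in> over c" "u \<in> over c'"
  shows "((\<lambda>w. jac c c' (fst w) a' a) has_derivative
    (\<lambda>v. frechet_derivative (\<lambda>x. jac c c' x a' a) (at (fst (tcoords c u))) (fst v))) (at (tcoords c u))"
  using has_derivative_compose[OF has_derivative_fst[OF has_derivative_ident],
      of "\<lambda>x. jac c c' x a' a" "frechet_derivative (\<lambda>x. jac c c' x a' a) (at (fst (tcoords c u)))" "tcoords c u" UNIV]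
    jac_differentiable[OF assms]
  by (simp add: frechet_derivative_works[symmetric])

text \<open>The fibre coordinates change by a Jacobian that varies with the base point. The product
  rule therefore adds a term with the derivative of the Jacobian, the source of the Hessian in the
  law of \<open>N\<close>.\<close>

lemma tchange_has_derivative:
  assumes "c \<in> A" "c' \<in> A" "u \<in> over c" "u \<in> over c'"
  defines "x \<equiv> snd c (fst u)"
  shows "(tchange c c' has_derivative (\<lambda>(v, w). (jac_apply c c' x v,
    \<chi> a'. \<Sum>a\<in>UNIV. jac c c' x a' a * w $ a +
      frechet_derivative (\<lambda>x. jac c c' x a' a) (at x) v * snd u c $ a))) (at (tcoords c u))"
proof -
  have 1: "((\<lambda>z. transition c c' (fst z)) has_derivative (\<lambda>v. jac_apply c c' x (fst v))) (at (tcoords c u))"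
    unfolding x_def
    by (rule has_derivative_compose[OF has_derivative_fst[OF has_derivative_ident]])
       (use transition_has_derivative assms in \<open>auto simp: tcoords_def over_def\<close>)
  have 2: "((\<lambda>z. jac_apply c c' (fst z) (snd z)) has_derivative (\<lambda>v. \<chi> a'. \<Sum>a\<in>UNIV.
      jac c c' x a' a * snd v $ a + frechet_derivative (\<lambda>x. jac c c' x a' a) (at x) (fst v) * snd u c $ a))
      (at (tcoords c u))"
    unfolding jac_apply_def
  proof (intro has_derivative_vec_lambda has_derivative_sum)
    fix a' a
    have "((\<lambda>z. snd z $ a) has_derivative (\<lambda>v. snd v $ a)) (at (tcoords c u))"
      by (intro bounded_linear.has_derivative[OF bounded_linear_vec_nth] has_derivative_snd has_derivative_ident)
    from has_derivative_mult[OF jac_fst_has_derivative[OF assms(1-4), of a' a] this]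
    show "((\<lambda>z. jac c c' (fst z) a' a * snd z $ a) has_derivative (\<lambda>v. jac c c' x a' a * snd v $ a +
        frechet_derivative (\<lambda>x. jac c c' x a' a) (at x) (fst v) * snd u c $ a)) (at (tcoords c u))"
      by (simp add: tcoords_def x_def)
  qed
  show ?thesis
    using has_derivative_Pair[OF 1 2] by (simp add: tchange_def[abs_def] case_prod_beta')
qed

end

section \<open>GAP-spaces\<close>

locale gap_space = smooth_atlas X A
  for X :: "'m topology" and A :: "('m, 'n::finite) chart set" +
  fixes lam :: "'n \<Rightarrow> ('m, 'n) tangent \<Rightarrow> ('m, 'n) tangent"
  assumes gap: "GAP_space X A lam"
begin

lemma section_lam: "pullback_section A (lam i)"
  using gap by (simp add: GAP_space_def)

lemma frame_smooth: "c \<in> A \<Longrightarrow> smooth_on (\<lambda>z. frame A lam c z i a) (tdom c)"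
  using section_lam by (simp add: frame_def pullback_section_def)

text \<open>The rows of the matrix are the component vectors of the sections; their independence
  gives a right inverse, and for a square matrix this is an inverse.\<close>

lemma invertible_frame:
  assumes "c \<in> A" "z \<in> tdom c"
  shows "invertible (\<chi> i a. frame A lam c z i a)"
proof -
  let ?M = "(\<chi> i a. frame A lam c z i a) :: real ^ 'n ^ 'n"
  obtain u where u: "u \<in> over c" "z = tcoords c u"
    using assms tdom_eq by blast
  have "row i ?M = snd (lam i u) c" for i
    using assms u by (simp add: row_def frame_def components_tcoords vec_eq_iff)
  then have "\<exists>B. ?M ** B = mat 1"
    using gap u assms by (auto simp: matrix_right_invertible_independent_rows scalar_mult_eq_scaleR GAP_space_def over_def)
  then show ?thesis
    by (simp add: invertible_right_inverse)
qed

lemma dual: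
  assumes "c \<in> A" "z \<in> tdom c"
  shows "(\<Sum>a\<in>UNIV. frame A lam c z i a * coframe A lam c z j a) = (if i = j then 1 else 0)"
    and "(\<Sum>i\<in>UNIV. frame A lam c z i a * coframe A lam c z i b) = (if a = b then 1 else 0)"
proof -
  note inv = invertible_matrix_inv[OF invertible_frame[OF assms]]
  show "(\<Sum>a\<in>UNIV. frame A lam c z i a * coframe A lam c z j a) = (if i = j then 1 else 0)"
    using arg_cong[OF inv(1), of "\<lambda>M. M $ i $ j"] by (simp add: matrix_matrix_mult_def mat_def coframe_def)
  show "(\<Sum>i\<in>UNIV. frame A lam c z i a * coframe A lam c z i b) = (if a = b then 1 else 0)"
    using arg_cong[OF inv(2), of "\<lambda>M. M $ b $ a"]
    by (simp add: matrix_matrix_mult_def mat_def coframe_def mult.commute eq_commute)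
qed

lemma coframe_smooth: "c \<in> A \<Longrightarrow> smooth_on (\<lambda>z. coframe A lam c z i a) (tdom c)"
  unfolding coframe_def by (intro smooth_on_matrix_inv open_tdom frame_smooth invertible_frame)

lemma dual_frames_lam:
  assumes "c \<in> A" "z \<in> tdom c" "derivation_at d Y z"
  shows "dual_frames d Y z (frame A lam c) (coframe A lam c) (tdom c)"
proof -
  interpret derivation_at d Y z by fact
  show ?thesis
    by unfold_locales
      (simp_all add: assms open_tdom dual smooth_on_differentiable[OF frame_smooth[OF assms(1)] assms(2)]
        smooth_on_differentiable[OF coframe_smooth[OF assms(1)] assms(2)])
qed

lemma frame_change:
  "c \<in> A \<Longrightarrow> c' \<in> A \<Longrightarrow> u \<in> over c \<Longrightarrow> u \<in> over c' \<Longrightarrow> frame A lam c' (tcoords c' u) i a' =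
    (\<Sum>a\<in>UNIV. jac c c' (snd c (fst u)) a' a * frame A lam c (tcoords c u) i a)"
  unfolding frame_def by (rule components_change[OF section_lam])

text \<open>The right-hand side is dual to the frame in the second chart, hence equal to the coframe there.\<close>

lemma coframe_change:
  assumes "c \<in> A" "c' \<in> A" "u \<in> over c" "u \<in> over c'"
  shows "coframe A lam c' (tcoords c' u) i m' =
    (\<Sum>m\<in>UNIV. jac c' c (snd c' (fst u)) m m' * coframe A lam c (tcoords c u) i m)"
proof -
  let ?f = "frame A lam c (tcoords c u)" and ?h = "coframe A lam c (tcoords c u)"
  let ?f' = "frame A lam c' (tcoords c' u)" and ?h' = "coframe A lam c' (tcoords c' u)"
  let ?Q = "jac c c' (snd c (fst u))" and ?P = "jac c' c (snd c' (fst u))"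
  have u: "tcoords c u \<in> tdom c" "tcoords c' u \<in> tdom c'"
    using assms by (auto simp: tdom_eq)
  define K where "K m' = (\<Sum>m\<in>UNIV. ?P m m' * ?h i m)" for m'
  have "(\<Sum>m'\<in>UNIV. ?f' j m' * K m') = (if j = i then 1 else 0)" for j
  proof -
    have PQ: "(\<Sum>m'\<in>UNIV. ?P m m' * ?Q m' a) = (if m = a then 1 else 0)" for m a
      using assms by (intro jac_mult_jac) (auto simp: over_def)
    have "(\<Sum>m'\<in>UNIV. ?f' j m' * K m') = (\<Sum>m\<in>UNIV. ?h i m * (\<Sum>m'\<in>UNIV. ?P m m' * ?f' j m'))"
      unfolding K_def sum_distrib_left by (subst sum.swap) (simp add: ac_simps)
    also have "\<dots> = (\<Sum>m\<in>UNIV. ?h i m * ?f j m)"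
      unfolding frame_change[OF assms]
      by (subst sum_contract(1)[of "\<lambda>m' m. ?P m m'" ?Q]) (simp_all add: PQ)
    finally show ?thesis
      using dual(1)[OF assms(1) u(1), of j i] by (simp add: mult.commute)
  qed
  \<comment> \<open>The coframe component and \<open>K\<close> have the same contractions with all
    frame vectors; a further contraction with the coframe over \<open>j\<close> isolates the index
    \<open>m'\<close>.\<close>
  then have "(\<Sum>j\<in>UNIV. ?h' j m' * (\<Sum>b\<in>UNIV. ?f' j b * ?h' i b)) =
      (\<Sum>j\<in>UNIV. ?h' j m' * (\<Sum>b\<in>UNIV. ?f' j b * K b))"
    using dual(1)[OF assms(2) u(2)] by simp
  moreover have "(\<Sum>j\<in>UNIV. ?h' j m' * (\<Sum>b\<in>UNIV. ?f' j b * T b)) = T m'" for T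
    using dual(2)[OF assms(2) u(2)]
    by (intro sum_contract(1)) (simp only: mult.commute[of "?h' _ _" "?f' _ _"], simp only: eq_commute)
  ultimately show ?thesis
    by (simp add: K_def)
qed

text \<open>The h-part is the case \<open>b = 1\<close> and the v-part the case \<open>b = 0\<close>.\<close>

lemma weitzenboeck_change:
  assumes cu: "c \<in> A" "c' \<in> A" "u \<in> over c" "u \<in> over c'"
    and d: "derivation_at d Y (tcoords c u)" "derivation_at d' Y' (tcoords c' u)"
    and fst_Y: "\<And>n. fst (Y n) = b *\<^sub>R axis n 1" "\<And>n'. fst (Y' n') = b *\<^sub>R axis n' 1"
    and snd_Y: "\<And>n' a. (\<Sum>a'\<in>UNIV. jac c' c (snd c' (fst u)) a a' * snd (Y' n') $ a' +
        b * hess c' c (snd c' (fst u)) a n' a' * snd u c' $ a') =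
      (\<Sum>n\<in>UNIV. jac c' c (snd c' (fst u)) n n' * snd (Y n) $ a)"
  shows "weitzenboeck d' (frame A lam c') (coframe A lam c') (tcoords c' u) a' m' n' =
    (\<Sum>a\<in>UNIV. \<Sum>m\<in>UNIV. \<Sum>n\<in>UNIV. jac c c' (snd c (fst u)) a' a * jac c' c (snd c' (fst u)) m m' *
       jac c' c (snd c' (fst u)) n n' * weitzenboeck d (frame A lam c) (coframe A lam c) (tcoords c u) a m n) +
    (\<Sum>e\<in>UNIV. jac c c' (snd c (fst u)) a' e * (b * hess c' c (snd c' (fst u)) e m' n'))"
proof -
  let ?x' = "snd c' (fst u)"
  have z: "tcoords c u \<in> tdom c"
    using cu by (simp add: tdom_eq)
  interpret dual_frames d Y "tcoords c u" "frame A lam c" "coframe A lam c" "tdom c"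
    using cu(1) z d(1) by (rule dual_frames_lam)
  interpret d': derivation_at d' Y' "tcoords c' u" by fact
  have lin: "linear (frechet_derivative (\<lambda>x. jac c' c x a a') (at ?x'))" for a a'
    using jac_differentiable[OF cu(2,1,4,3)] by (intro linear_frechet_derivative) (simp add: tcoords_def)
  have hess: "frechet_derivative (\<lambda>x. jac c' c x a a') (at ?x') (b *\<^sub>R axis n' 1) = b * hess c' c ?x' a n' a'" for a a' n'
    using linear_cmul[OF lin] by (simp add: hess_def)
  \<comment> \<open>Differentiating in direction \<open>n'\<close> yields the Hessian with
    \<open>n'\<close> before \<open>m'\<close>; \<open>hess_commute\<close> restores the order of
    the transformation law.\<close>
  have deriv: "d' n' (\<lambda>w. jac c' c (fst w) e m') (tcoords c' u) = b * hess c' c ?x' e m' n'" for e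
    using d'.has_derivative[OF jac_fst_has_derivative[OF cu(2,1,4,3)]] cu
    by (simp add: fst_Y hess tcoords_def) (simp add: over_def hess_commute)
  let ?D = "\<lambda>(v, w). (jac_apply c' c ?x' v, \<chi> a. \<Sum>a'\<in>UNIV. jac c' c ?x' a a' * w $ a' +
      frechet_derivative (\<lambda>x. jac c' c x a a') (at ?x') v * snd u c' $ a')"
  \<comment> \<open>The differential of the coordinate change carries \<open>Y'\<close> to the
    combination of the \<open>Y n\<close> given by the Jacobian: in the base by
    \<open>fst_Y\<close>, in the fibre by \<open>snd_Y\<close>.\<close>
  have D: "?D (Y' n') = (\<Sum>n\<in>UNIV. jac c' c ?x' n n' *\<^sub>R Y n)" for n'
  proof (rule prod_eqI)
    show "fst (?D (Y' n')) = fst (\<Sum>n\<in>UNIV. jac c' c ?x' n n' *\<^sub>R Y n)"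
      by (simp add: case_prod_beta' vec_eq_iff fst_sum fst_Y jac_apply_def
          axis_def if_distrib[of "\<lambda>x. _ * x"] cong: if_cong)
    show "snd (?D (Y' n')) = snd (\<Sum>n\<in>UNIV. jac c' c ?x' n n' *\<^sub>R Y n)"
      by (simp add: case_prod_beta' vec_eq_iff snd_sum fst_Y hess snd_Y)
  qed
  have fst_tcoords: "fst (tcoords c' u) = ?x'"
    by (simp add: tcoords_def)
  have "weitzenboeck d' (frame A lam c') (coframe A lam c') (tcoords c' u) a' m' n' =
    (\<Sum>a\<in>UNIV. \<Sum>m\<in>UNIV. \<Sum>n\<in>UNIV. jac c c' (snd c (fst u)) a' a * jac c' c (fst (tcoords c' u)) m m' *
       jac c' c (fst (tcoords c' u)) n n' * weitzenboeck d (frame A lam c) (coframe A lam c) (tcoords c u) a m n) +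
    (\<Sum>e\<in>UNIV. jac c c' (snd c (fst u)) a' e * d' n' (\<lambda>w. jac c' c (fst w) e m') (tcoords c' u))"
  proof (rule weitzenboeck_transform[OF d(2) open_tcoords_overlap[OF cu(2,1)] _
        tchange_has_derivative[OF cu(2,1,4,3)] tchange_tcoords[OF cu(2,1,4,3)]])
    show "tcoords c' u \<in> tcoords c' ` (over c' \<inter> over c)"
      using cu by blast
    show "?D (Y' n') = (\<Sum>n\<in>UNIV. jac c' c (fst (tcoords c' u)) n n' *\<^sub>R Y n)" for n'
      unfolding fst_tcoords by (rule D)
    show "(\<lambda>w. jac c' c (fst w) m m') differentiable (at (tcoords c' u))" for m m'
      by (rule differentiableI[OF jac_fst_has_derivative[OF cu(2,1,4,3)]])
    show "frame A lam c' (tcoords c' u) i a' =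
        (\<Sum>a\<in>UNIV. jac c c' (snd c (fst u)) a' a * frame A lam c (tcoords c u) i a)" for i a'
      by (rule frame_change[OF cu])
    show "coframe A lam c' w i m' = (\<Sum>m\<in>UNIV. jac c' c (fst w) m m' * coframe A lam c (tchange c' c w) i m)"
      if "w \<in> tcoords c' ` (over c' \<inter> over c)" for w i m'
    proof -
      obtain t where t: "t \<in> over c" "t \<in> over c'" "w = tcoords c' t"
        using \<open>w \<in> _\<close> by blast
      show ?thesis
        unfolding t(3) tchange_tcoords[OF cu(2,1) t(2,1)] coframe_change[OF cu(1,2) t(1,2)]
        by (simp add: tcoords_def)
    qed
  qed
  then show ?thesis
    by (simp only: fst_tcoords deriv)
qed

section \<open>The Weitzenboeck coefficients as a d-connection\<close>

definition weitzenboeck_h :: "('m, 'n) system2 \<Rightarrow> ('m, 'n) system3" where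
  "weitzenboeck_h N c = weitzenboeck (delta (N c)) (frame A lam c) (coframe A lam c)"

definition weitzenboeck_v :: "('m, 'n) system3" where
  "weitzenboeck_v c = weitzenboeck dy (frame A lam c) (coframe A lam c)"

lemma h_coefficients_weitzenboeck_h:
  assumes N: "nonlinear_connection A N"
  shows "h_coefficients A (weitzenboeck_h N)"
proof -
  have "smooth_on (\<lambda>z. weitzenboeck_h N c z a m n) (tdom c)" if c: "c \<in> A" for c a m n
    using c N unfolding weitzenboeck_h_def weitzenboeck_def delta_def dx_def dy_def nonlinear_connection_def
    by (intro smooth_on_sum smooth_on_mult smooth_on_diff smooth_on_frechet_derivative open_tdom
        frame_smooth coframe_smooth) auto
  moreover have "weitzenboeck_h N c' (tcoords c' u) a' m' n' =
      (\<Sum>a\<in>UNIV. \<Sum>m\<in>UNIV. \<Sum>n\<in>UNIV. jac c c' (snd c (fst u)) a' a * jac c' c (snd c' (fst u)) m m' *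
         jac c' c (snd c' (fst u)) n n' * weitzenboeck_h N c (tcoords c u) a m n) +
      (\<Sum>e\<in>UNIV. jac c c' (snd c (fst u)) a' e * hess c' c (snd c' (fst u)) e m' n')"
    if cu: "c \<in> A" "c' \<in> A" "u \<in> over c" "u \<in> over c'" for c c' u a' m' n'
  proof -
    let ?P = "jac c' c (snd c' (fst u))" and ?Q = "jac c c' (snd c (fst u))"
    let ?H = "hess c' c (snd c' (fst u))" and ?y' = "snd u c'"
    have N': "N c' (tcoords c' u) b n' = (\<Sum>a\<in>UNIV. ?Q b a * (\<Sum>n\<in>UNIV. ?P n n' * N c (tcoords c u) a n)) +
        (\<Sum>e\<in>UNIV. ?Q b e * (\<Sum>s\<in>UNIV. ?H e n' s * ?y' $ s))" for b n'
      using N cu by (simp add: nonlinear_connection_def over_def tcoords_def sum_distrib_left mult.assoc)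
    have PQ: "(\<Sum>b\<in>UNIV. ?P a b * ?Q b a') = (if a = a' then 1 else 0)" for a a'
      using cu by (intro jac_mult_jac) (auto simp: over_def)
    \<comment> \<open>The law of \<open>N\<close>, freed from the Jacobian on its upper index by
      contraction with the inverse one. Up to sign this is the condition \<open>snd_Y\<close> for
      the horizontal vectors.\<close>
    have PN: "(\<Sum>b\<in>UNIV. ?P a b * N c' (tcoords c' u) b n') =
        (\<Sum>n\<in>UNIV. ?P n n' * N c (tcoords c u) a n) + (\<Sum>s\<in>UNIV. ?H a n' s * ?y' $ s)" for a n'
      unfolding N' distrib_left sum.distrib
      by (simp only: sum_contract(1)[of "\<lambda>b a. ?P a b" ?Q, OF PQ])
    show ?thesis
      unfolding weitzenboeck_h_def
      by (subst weitzenboeck_change[OF cu derivation_at_delta derivation_at_delta, where b = 1])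
         (simp_all add: sum.distrib sum_negf sum_subtractf PN)
  qed
  ultimately show ?thesis
    unfolding h_coefficients_def tcoords_def over_def Let_def prod.case by blast
qed

text \<open>The vertical coordinate vectors change by the Jacobian alone, since the coordinate
  change is linear in the fibre; with \<open>b = 0\<close> the Hessian terms vanish and a tensor law
  is left.\<close>

lemma tensor_weitzenboeck_v: "tensor_1_2 A weitzenboeck_v"
proof -
  have "smooth_on (\<lambda>z. weitzenboeck_v c z a m n) (tdom c)" if c: "c \<in> A" for c a m n
    using c unfolding weitzenboeck_v_def weitzenboeck_def dy_def
    by (intro smooth_on_sum smooth_on_mult smooth_on_frechet_derivative open_tdom frame_smooth coframe_smooth)
  moreover have "weitzenboeck_v c' (tcoords c' u) a' m' n' =
      (\<Sum>a\<in>UNIV. \<Sum>m\<in>UNIV. \<Sum>n\<in>UNIV. jac c c' (snd c (fst u)) a' a * jac c' c (snd c' (fst u)) m m' *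
         jac c' c (snd c' (fst u)) n n' * weitzenboeck_v c (tcoords c u) a m n)"
    if cu: "c \<in> A" "c' \<in> A" "u \<in> over c" "u \<in> over c'" for c c' u a' m' n'
    unfolding weitzenboeck_v_def
    by (subst weitzenboeck_change[OF cu derivation_at_dy derivation_at_dy, where b = 0])
       (simp_all add: axis_def if_distrib[of "\<lambda>x. _ * x"] cong: if_cong)
  ultimately show ?thesis
    unfolding tensor_1_2_def tcoords_def over_def Let_def prod.case by blast
qed

end

theorem theorem3p3:
  fixes X :: "'m topology"
    and A :: "('m, 'n::finite) chart set"
    and lam :: "'n \<Rightarrow> ('m, 'n) tangent \<Rightarrow> ('m, 'n) tangent"
    and N :: "('m, 'n) system2"
  assumes "GAP_space X A lam"
    and "nonlinear_connection A N"
  shows "\<exists>\<Gamma> C. d_connection A N \<Gamma> C \<and> frame_parallel A lam N \<Gamma> C \<and>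
    (\<forall>\<Gamma>' C'. d_connection A N \<Gamma>' C' \<and> frame_parallel A lam N \<Gamma>' C' \<longrightarrow>
       same_system A \<Gamma>' \<Gamma> \<and> same_system A C' C) \<and>
    (\<forall>c\<in>A. \<forall>z\<in>tdom c. \<forall>a m n.
       \<Gamma> c z a m n = riemann_\<Gamma> A lam N c z a m n +
         (\<Sum>i\<in>UNIV. frame A lam c z i a *
            cov_covector (delta (N c)) (riemann_\<Gamma> A lam N c) (\<lambda>w. coframe A lam c w i) z m n) \<and>
       C c z a m n = riemann_C A lam c z a m n +
         (\<Sum>i\<in>UNIV. frame A lam c z i a *
            cov_covector dy (riemann_C A lam c) (\<lambda>w. coframe A lam c w i) z m n)) \<and>
    metrical A lam N \<Gamma> C"
proof -
  interpret gap_space X A lam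
    using assms(1) by unfold_locales (simp_all add: GAP_space_def)
  have h: "dual_frames (delta (N c)) (\<lambda>n. (axis n 1, - (\<chi> a. N c z a n))) z (frame A lam c) (coframe A lam c) (tdom c)"
    and v: "dual_frames dy (\<lambda>n. (0, axis n 1)) z (frame A lam c) (coframe A lam c) (tdom c)"
    if "c \<in> A" "z \<in> tdom c" for c z
    using that by (auto intro: dual_frames_lam derivation_at_delta derivation_at_dy)
  \<comment> \<open>Stated for arbitrary \<open>d\<close> and \<open>G\<close>, to be instantiated
    with the two kinds of Riemannian coefficients.\<close>
  have formula: "weitzenboeck d (frame A lam c) (coframe A lam c) z a m n = G z a m n +
      (\<Sum>i\<in>UNIV. frame A lam c z i a * cov_covector d G (\<lambda>w. coframe A lam c w i) z m n)"
    if "c \<in> A" "z \<in> tdom c" for c z d G a m n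
    using that by (intro weitzenboeck_eq_plus_contortion dual(2))
  have "d_connection A N (weitzenboeck_h N) weitzenboeck_v"
    by (simp add: d_connection_def assms(2) h_coefficients_weitzenboeck_h tensor_weitzenboeck_v)
  moreover have "frame_parallel A lam N (weitzenboeck_h N) weitzenboeck_v"
    using h[THEN dual_frames.weitzenboeck_parallel] v[THEN dual_frames.weitzenboeck_parallel]
    by (simp add: frame_parallel_def weitzenboeck_h_def weitzenboeck_v_def)
  moreover have "same_system A \<Gamma>' (weitzenboeck_h N) \<and> same_system A C' weitzenboeck_v"
    if "frame_parallel A lam N \<Gamma>' C'" for \<Gamma>' C'
    using that h[THEN dual_frames.weitzenboeck_unique] v[THEN dual_frames.weitzenboeck_unique]
    by (simp add: frame_parallel_def same_system_def weitzenboeck_h_def weitzenboeck_v_def fun_eq_iff)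
  \<comment> \<open>Exhibits the metric as the function of the point for which
    \<open>weitzenboeck_metrical\<close> is stated.\<close>
  moreover have "Defs.metric A lam c = (\<lambda>w m n. \<Sum>i\<in>UNIV. coframe A lam c w i m * coframe A lam c w i n)" for c
    by (simp add: fun_eq_iff metric_def)
  then have "metrical A lam N (weitzenboeck_h N) weitzenboeck_v"
    using h[THEN dual_frames.weitzenboeck_metrical] v[THEN dual_frames.weitzenboeck_metrical]
    by (simp add: metrical_def weitzenboeck_h_def weitzenboeck_v_def)
  ultimately show ?thesis
    using formula
    by (intro exI[of _ "weitzenboeck_h N"] exI[of _ weitzenboeck_v]) (auto simp: weitzenboeck_h_def weitzenboeck_v_def)
qed

end
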